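(* Let $V$ be a group-like set. Then $V$ is $\mathbb{Q}$-like if and only if $\mathbb{Q}\cap[0,1]\subseteq V$ and $\mathrm{Homeo}(2^{\mathbb{N}},\mu_V)$ has the Rokhlin property.
   Context: All measures are Borel probability measures; $2^{\mathbb{N}}$ is the Cantor space. A measure is full if it is positive on every nonempty open set; the clopen values set of $\mu$ is $\{\mu(U): U\text{ clopen}\}$. A full measure $\mu$ on $2^{\mathbb{N}}$ is good if whenever $U,W$ are clopen with $\mu(U)<\mu(W)$, there is a clopen $W'\subseteq W$ with $\mu(W')=\mu(U)$. A set $V$ is group-like if it is countably infinite, $\{0,1\}\subseteq V\subseteq[0,1]$, and $V+\mathbb{Z}$ is an additive subgroup of $\mathbb{R}$. A group-like set $V$ is $\mathbb{Q}$-like if $V+\mathbb{Z}$ is a $\mathbb{Q}$-vector subspace of $\mathbb{R}$. For group-like $V$, $\mu_V$ denotes the good measure on $2^{\mathbb{N}}$ with clopen values set $V$ (it exists and is unique up to homeomorphism). $\mathrm{Homeo}(2^{\mathbb{N}},\mu_V)$ is the Polish group (compact-open topology) of homeomorphisms of $2^{\mathbb{N}}$ preserving $\mu_V$. A Polish group has the Rokhlin property if it admits a dense conjugacy class. *)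

theory Defs
  imports
    "HOL-Analysis.Analysis"
    "HOL-Probability.Probability_Measure"
    "HOL-Library.Set_Algebras"
    "HOL-Algebra.Group"
begin

text \<open>The Cantor space is the type \<^typ>\<open>nat \<Rightarrow> bool\<close> with the product topology of the library.\<close>

type_synonym cantor = "nat \<Rightarrow> bool"

definition clopen :: "'a::topological_space set \<Rightarrow> bool" where
  "clopen U \<longleftrightarrow> open U \<and> closed U"

definition borel_prob :: "'a::topological_space measure \<Rightarrow> bool" where
  "borel_prob \<mu> \<longleftrightarrow> prob_space \<mu> \<and> sets \<mu> = sets borel"

definition full_measure :: "'a::topological_space measure \<Rightarrow> bool" where
  "full_measure \<mu> \<longleftrightarrow> borel_prob \<mu> \<and> (\<forall>U. open U \<and> U \<noteq> {} \<longrightarrow> measure \<mu> U > 0)"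

definition clopen_values :: "'a::topological_space measure \<Rightarrow> real set" where
  "clopen_values \<mu> = {measure \<mu> U | U. clopen U}"

definition good_measure :: "cantor measure \<Rightarrow> bool" where
  "good_measure \<mu> \<longleftrightarrow> full_measure \<mu> \<and>
     (\<forall>U W. clopen U \<and> clopen W \<and> measure \<mu> U < measure \<mu> W \<longrightarrow>
        (\<exists>W'. clopen W' \<and> W' \<subseteq> W \<and> measure \<mu> W' = measure \<mu> U))"

definition real_add_group :: "real monoid" where
  "real_add_group = \<lparr>carrier = UNIV, monoid.mult = (+), one = 0\<rparr>"

text \<open>Below, \<^term>\<open>V + \<int>\<close> is the elementwise sum of sets.\<close>

definition group_like :: "real set \<Rightarrow> bool" where
  "group_like V \<longleftrightarrow> countable V \<and> infinite V \<and> {0, 1} \<subseteq> V \<and> V \<subseteq> {0..1} \<and>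
     subgroup (V + \<int>) real_add_group"

definition Q_like :: "real set \<Rightarrow> bool" where
  "Q_like V \<longleftrightarrow> group_like V \<and>
     module.subspace (\<lambda>(q::rat) (x::real). of_rat q * x) (V + \<int>)"

text \<open>The good measures with clopen values set \<open>V\<close>. For group-like \<open>V\<close> there is one, unique up
  to a homeomorphism of the Cantor space, so we treat ``\<open>\<mu>\<close> is \<open>\<mu>\<^sub>V\<close>'' as a predicate on \<open>\<mu>\<close>.\<close>

definition is_mu :: "real set \<Rightarrow> cantor measure \<Rightarrow> bool" where
  "is_mu V \<mu> \<longleftrightarrow> good_measure \<mu> \<and> clopen_values \<mu> = V"

definition Homeo :: "'a::topological_space measure \<Rightarrow> ('a \<Rightarrow> 'a) monoid" where
  "Homeo \<mu> =
     \<lparr>carrier = {f. homeomorphic_map euclidean euclidean f \<and> distr \<mu> \<mu> f = \<mu>},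
      monoid.mult = (\<circ>), one = id\<rparr>"

lemma group_Homeo:
  fixes \<mu> :: "'a::topological_space measure"
  assumes sets: "sets \<mu> = sets borel"
  shows "group (Homeo \<mu>)"
proof (rule groupI)
  have meas: "f \<in> measurable \<mu> \<mu>" if "homeomorphic_map euclidean euclidean f" for f :: "'a \<Rightarrow> 'a"
  proof -
    have "continuous_on UNIV f"
      using homeomorphic_imp_continuous_map [OF that] by simp
    then show ?thesis
      using borel_measurable_continuous_onI measurable_cong_sets [OF sets sets] by blast
  qed
  show "x \<otimes>\<^bsub>Homeo \<mu>\<^esub> y \<in> carrier (Homeo \<mu>)"
    if "x \<in> carrier (Homeo \<mu>)" "y \<in> carrier (Homeo \<mu>)" for x y
    using that distr_distr [of x \<mu> \<mu> y \<mu>] homeomorphic_map_compose [of euclidean euclidean y euclidean x]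
    by (auto simp: Homeo_def meas)
  show "\<one>\<^bsub>Homeo \<mu>\<^esub> \<in> carrier (Homeo \<mu>)"
    using distr_id [of \<mu>] by (simp add: Homeo_def flip: id_def)
  show "\<exists>y\<in>carrier (Homeo \<mu>). y \<otimes>\<^bsub>Homeo \<mu>\<^esub> x = \<one>\<^bsub>Homeo \<mu>\<^esub>"
    if x: "x \<in> carrier (Homeo \<mu>)" for x
  proof -
    have hx: "homeomorphic_map euclidean euclidean x" and dx: "distr \<mu> \<mu> x = \<mu>"
      using x by (auto simp: Homeo_def)
    obtain g where g: "homeomorphic_maps euclidean euclidean x g"
      using hx homeomorphic_map_maps by blast
    then have gx: "g \<circ> x = id" and hg: "homeomorphic_map euclidean euclidean g"
      by (auto simp: homeomorphic_maps_def fun_eq_iff)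
        (metis g homeomorphic_maps_map homeomorphic_maps_sym)
    have "distr \<mu> \<mu> g = distr (distr \<mu> \<mu> x) \<mu> g"
      by (simp add: dx)
    also have "\<dots> = distr \<mu> \<mu> (g \<circ> x)"
      by (rule distr_distr) (auto intro: meas hx hg)
    also have "\<dots> = \<mu>"
      using distr_id [of \<mu>] by (simp add: gx flip: id_def)
    finally show ?thesis
      using gx hg by (auto simp: Homeo_def)
  qed
qed (auto simp: Homeo_def comp_assoc)

definition compact_open_topology ::
    "('a::topological_space \<Rightarrow> 'b::topological_space) topology" where
  "compact_open_topology =
     subtopology (topology_generated_by {{f. f ` K \<subseteq> U} | K U. compact K \<and> open U})
       {f. continuous_on UNIV f}"

definition Homeo_topology ::
    "'a::topological_space measure \<Rightarrow> ('a \<Rightarrow> 'a) topology" where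
  "Homeo_topology \<mu> = subtopology compact_open_topology (carrier (Homeo \<mu>))"

definition conjugacy_class :: "('g, 'm) monoid_scheme \<Rightarrow> 'g \<Rightarrow> 'g set" where
  "conjugacy_class G g =
     {h \<otimes>\<^bsub>G\<^esub> g \<otimes>\<^bsub>G\<^esub> inv\<^bsub>G\<^esub> h | h. h \<in> carrier G}"

text \<open>Intended for a Polish group \<open>G\<close>, with \<open>T\<close> its topology on \<^term>\<open>carrier G\<close>.\<close>

definition Rokhlin_property :: "('g, 'm) monoid_scheme \<Rightarrow> 'g topology \<Rightarrow> bool" where
  "Rokhlin_property G T \<longleftrightarrow>
     (\<exists>g \<in> carrier G. T closure_of conjugacy_class G g = topspace T)"

end

theory Submission
  imports Defs
begin

text \<open>
  A good measure is homogeneous: by a back-and-forth construction, any two clopen sets of equal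
  measure are exchanged by an element of the group \<open>G = Homeo \<mu>\<close>. Call \<open>f \<in> G\<close> \<^emph>\<open>periodic\<close> of
  period \<open>N\<close> if \<open>f\<^sup>N = id\<close> and the space is the disjoint union of \<open>A, f A, \<dots>, f\<^sup>N\<^sup>-\<^sup>1 A\<close> for a
  clopen \<open>A\<close>; by homogeneity all such elements are conjugate in \<open>G\<close>.

  Suppose that \<open>V\<close> is divisible. For \<open>f \<in> G\<close> and a clopen partition \<open>P\<close>, the numbers
  \<open>\<mu> (P\<^sub>i \<inter> f\<^sup>-\<^sup>1 P\<^sub>j)\<close> are a circulation on a finite graph, hence a sum of weighted cycles. Splitting
  each cycle evenly, one approximates \<open>f\<close> by elements of period \<open>N\<close>, for every multiple \<open>N\<close> of some
  \<open>L\<close>. So any two nonempty open subsets of \<open>G\<close> contain conjugate elements, and a Baire category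
  argument, carried out as an explicit limit, gives a dense conjugacy class.

  Conversely, let \<open>h\<close> have a dense conjugacy class and let \<open>1/N, v \<in> V\<close>. Since \<open>h\<close> has conjugates
  close to an element of period \<open>N\<close> and close to the identity, \<open>h\<close> permutes cyclically \<open>N\<close> clopen
  sets partitioning the space and fixes a clopen set of measure \<open>v\<close>; their intersections have
  measure \<open>v/N\<close>.
\<close>

subsection \<open>Locally constant functions on the Cantor space\<close>

text \<open>\<open>{y. agree n x y}\<close> is the cylinder of depth \<open>n\<close> around
  \<open>x\<close>. Closeness of homeomorphisms is measured the same way: their values agree to
  depth \<open>n\<close> at every point.\<close>

definition agree :: "nat \<Rightarrow> cantor \<Rightarrow> cantor \<Rightarrow> bool" where
  "agree n x y \<longleftrightarrow> (\<forall>i<n. x i = y i)"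

text \<open>A locally constant function serves as a labelled finite clopen partition. The uniform
  depth is part of the definition; compactness supplies it in \<open>loc_constI\<close>.\<close>

definition loc_const :: "(cantor \<Rightarrow> 'a) \<Rightarrow> bool" where
  "loc_const p \<longleftrightarrow> (\<exists>n. \<forall>x y. agree n x y \<longrightarrow> p x = p y)"

lemma agree_refl [simp]: "agree n x x"
  by (simp add: agree_def)

lemma agree_sym: "agree n x y \<Longrightarrow> agree n y x"
  by (simp add: agree_def)

lemma agree_trans: "agree n x y \<Longrightarrow> agree n y z \<Longrightarrow> agree n x z"
  by (simp add: agree_def)

lemma agree_mono: "agree n x y \<Longrightarrow> m \<le> n \<Longrightarrow> agree m x y"
  by (simp add: agree_def)

lemma open_cylinder: "open {y. agree n x y}"
proof -
  have "open ((\<lambda>y. y i) -` {x i})" for i :: nat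
    by (rule open_vimage) (auto intro: open_discrete)
  then have "open (\<Inter>i\<in>{..<n}. (\<lambda>y. y i) -` {x i})"
    by (intro open_INT) auto
  also have "(\<Inter>i\<in>{..<n}. (\<lambda>y. y i) -` {x i}) = {y. agree n x y}"
    by (auto simp: agree_def)
  finally show ?thesis .
qed

text \<open>A basic open set of the product restricts finitely many coordinates, all below some
  \<open>n\<close>, and so contains a cylinder around each of its points.\<close>

lemma open_cantor_iff:
  fixes U :: "cantor set"
  shows "open U \<longleftrightarrow> (\<forall>x\<in>U. \<exists>n. \<forall>y. agree n x y \<longrightarrow> y \<in> U)"
proof
  assume "open U"
  then have o: "openin (product_topology (\<lambda>i. euclidean) UNIV) U"
    by (simp add: open_fun_def)
  show "\<forall>x\<in>U. \<exists>n. \<forall>y. agree n x y \<longrightarrow> y \<in> U"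
  proof
    fix x assume "x \<in> U"
    then obtain X where X: "x \<in> Pi\<^sub>E UNIV X" "Pi\<^sub>E UNIV X \<subseteq> U"
      and fin: "finite {i. X i \<noteq> (UNIV::bool set)}"
      using product_topology_open_contains_basis[OF o \<open>x \<in> U\<close>] unfolding topspace_euclidean by blast
    obtain n where n: "\<forall>i\<in>{i. X i \<noteq> UNIV}. i < n"
      using fin finite_nat_set_iff_bounded by auto
    have "y \<in> U" if "agree n x y" for y
    proof -
      have "y i \<in> X i" for i
      proof (cases "i < n")
        case True
        then have "y i = x i" using that by (simp add: agree_def)
        then show ?thesis using PiE_mem[OF X(1), of i] by simp
      next
        case False
        then have "X i = UNIV" using n by auto
        then show ?thesis by simp
      qed
      then show ?thesis
        using X(2) by (simp add: subset_iff PiE_iff)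
    qed
    then show "\<exists>n. \<forall>y. agree n x y \<longrightarrow> y \<in> U" by blast
  qed
next
  assume *: "\<forall>x\<in>U. \<exists>n. \<forall>y. agree n x y \<longrightarrow> y \<in> U"
  show "open U"
  proof (subst open_subopen, intro ballI)
    fix x assume "x \<in> U"
    then obtain n where "\<forall>y. agree n x y \<longrightarrow> y \<in> U"
      using * by blast
    then show "\<exists>T. open T \<and> x \<in> T \<and> T \<subseteq> U"
      using open_cylinder[of n x] by (intro exI[of _ "{y. agree n x y}"]) auto
  qed
qed

section \<open>Compactness of the Cantor space and uniform depths\<close>

lemma compact_cantor: "compact (UNIV :: cantor set)"
proof -
  have "compact_space (product_topology (\<lambda>i::nat. euclidean::bool topology) UNIV)"
    unfolding compact_space_product_topology
    by (simp add: compact_space_def finite_imp_compact)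
  then show ?thesis
    unfolding euclidean_product_topology
    by (simp add: compact_space_def)
qed

lemma compact_clopen: "clopen (U :: cantor set) \<Longrightarrow> compact U"
  using closed_Int_compact[OF _ compact_cantor, of U] by (simp add: clopen_def)

text \<open>Lebesgue number argument: finitely many of the local cylinders cover \<open>K\<close>,
  and the largest of their depths works. The hypothesis is about pairs near a common centre because
  a point and its neighbour end up in the cylinder of some other point.\<close>

lemma compact_cylinder_uniform:
  assumes "compact K"
    and local: "\<And>x. x \<in> K \<Longrightarrow> \<exists>n. \<forall>y z. agree n x y \<longrightarrow> agree n x z \<longrightarrow> R y z"
  shows "\<exists>n. \<forall>x\<in>K. \<forall>y. agree n x y \<longrightarrow> R x y"
proof -
  obtain N where N: "\<And>x y z. x \<in> K \<Longrightarrow> agree (N x) x y \<Longrightarrow> agree (N x) x z \<Longrightarrow> R y z"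
    using local by metis
  have "K \<subseteq> (\<Union>x\<in>K. {y. agree (N x) x y})"
    by auto
  then obtain D where D: "D \<subseteq> K" "finite D" "K \<subseteq> (\<Union>x\<in>D. {y. agree (N x) x y})"
    by (rule compactE_image[OF \<open>compact K\<close> open_cylinder])
  \<comment> \<open>The inserted \<open>0\<close> keeps \<open>Max\<close> meaningful when
    \<open>K\<close> is empty.\<close>
  define n where "n = Max (insert 0 (N ` D))"
  have "R x y" if "x \<in> K" "agree n x y" for x y
  proof -
    have "x \<in> (\<Union>x\<in>D. {y. agree (N x) x y})"
      using D(3) that(1) by (rule subsetD)
    then obtain z where z: "z \<in> D" "agree (N z) z x"
      by blast
    have "N z \<le> n"
      unfolding n_def using D(2) z(1) by (intro Max_ge) auto
    then have "agree (N z) z y"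
      using that(2) z(2) agree_mono agree_trans by blast
    then show "R x y"
      using z D(1) N by blast
  qed
  then show ?thesis by blast
qed

text \<open>A continuous map from a compact space to a discrete one is uniformly continuous.\<close>

lemma loc_constI:
  assumes "\<And>a. open (p -` {a})"
  shows "loc_const p"
proof -
  have local: "\<exists>n. \<forall>y z. agree n x y \<longrightarrow> agree n x z \<longrightarrow> p y = p z" for x
  proof -
    have "\<exists>n. \<forall>y. agree n x y \<longrightarrow> y \<in> p -` {p x}"
      by (rule bspec[OF assms[of "p x", unfolded open_cantor_iff]]) simp
    then obtain n where "\<forall>y. agree n x y \<longrightarrow> y \<in> p -` {p x}" ..
    then have "p y = p x" if "agree n x y" for y
      using that by blast
    then show ?thesis
      by metis
  qed
  have "\<exists>n. \<forall>x\<in>UNIV. \<forall>y. agree n x y \<longrightarrow> p x = p y"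
    by (rule compact_cylinder_uniform[OF compact_cantor local])
  then show ?thesis
    unfolding loc_const_def by simp
qed

lemma open_vimage_loc_const:
  assumes "loc_const p"
  shows "open (p -` A)"
proof -
  obtain n where n: "\<forall>x y. agree n x y \<longrightarrow> p x = p y"
    using assms unfolding loc_const_def ..
  show ?thesis
    unfolding open_cantor_iff
  proof (intro ballI exI allI impI)
    fix x y assume "x \<in> p -` A" "agree n x y"
    then show "y \<in> p -` A"
      using n[rule_format, of x y] by simp
  qed
qed

lemma clopen_vimage_loc_const: "loc_const p \<Longrightarrow> clopen (p -` A)"
  using open_vimage_loc_const[of p A] open_vimage_loc_const[of p "- A"]
  by (simp add: clopen_def closed_def vimage_Compl)

lemma clopen_iff_loc_const: "clopen U \<longleftrightarrow> loc_const (\<lambda>x. x \<in> U)"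
proof
  assume U: "clopen U"
  have "(\<lambda>x. x \<in> U) -` {a} = (if a then U else - U)" for a
    by auto
  then show "loc_const (\<lambda>x. x \<in> U)"
    using U by (intro loc_constI) (auto simp: clopen_def)
next
  assume "loc_const (\<lambda>x. x \<in> U)"
  then show "clopen U"
    using clopen_vimage_loc_const[of "\<lambda>x. x \<in> U" "{True}"] by (simp add: vimage_def)
qed

lemma clopen_Collect: "loc_const P \<Longrightarrow> clopen {x. P x}"
  by (simp add: clopen_iff_loc_const)

lemma loc_const_const [simp]: "loc_const (\<lambda>x. c)"
  by (simp add: loc_const_def)

lemma loc_const_comp: "loc_const p \<Longrightarrow> loc_const (\<lambda>x. F (p x))"
  unfolding loc_const_def by (elim ex_forward) simp

lemma loc_const_comp2:
  assumes "loc_const p" "loc_const q"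
  shows "loc_const (\<lambda>x. F (p x) (q x))"
proof -
  obtain m n where "\<forall>x y. agree m x y \<longrightarrow> p x = p y" "\<forall>x y. agree n x y \<longrightarrow> q x = q y"
    using assms unfolding loc_const_def by (elim exE)
  then have "\<forall>x y. agree (max m n) x y \<longrightarrow> F (p x) (q x) = F (p y) (q y)"
    by (metis agree_mono max.cobounded1 max.cobounded2)
  then show ?thesis unfolding loc_const_def by blast
qed

lemma loc_const_coord: "loc_const (\<lambda>x. x i)"
  unfolding loc_const_def agree_def by blast

lemma loc_const_prefix: "loc_const (\<lambda>x. map x [0..<n])"
  unfolding loc_const_def agree_def by (intro exI[of _ n]) auto

lemma agree_iff_prefix: "agree n x y \<longleftrightarrow> map x [0..<n] = map y [0..<n]"
  by (auto simp: agree_def)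

section \<open>Continuous self-maps of the Cantor space\<close>

lemma continuous_cantorI:
  assumes "\<And>i. loc_const (\<lambda>x. f x i)"
  shows "continuous_on UNIV (f :: cantor \<Rightarrow> cantor)"
proof (rule continuous_on_coordinatewise_then_product)
  fix i
  show "continuous_on UNIV (\<lambda>x. f x i)"
    using open_vimage_loc_const[OF assms] by (simp add: continuous_on_open_vimage)
qed

lemma loc_const_vimage:
  assumes "continuous_on UNIV (f :: cantor \<Rightarrow> cantor)" "loc_const p"
  shows "loc_const (\<lambda>x. p (f x))"
proof (rule loc_constI)
  fix a
  have "open (f -` (p -` {a}))"
    using assms by (intro open_vimage) (auto intro: open_vimage_loc_const)
  then show "open ((\<lambda>x. p (f x)) -` {a})"
    by (simp add: vimage_def)
qed

lemma continuous_modulus: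
  assumes "continuous_on UNIV (f :: cantor \<Rightarrow> cantor)"
  obtains n where "\<And>x y. agree n x y \<Longrightarrow> agree m (f x) (f y)"
proof -
  obtain n where "\<forall>x y. agree n x y \<longrightarrow> map (f x) [0..<m] = map (f y) [0..<m]"
    using loc_const_vimage[OF assms loc_const_prefix[of m]] unfolding loc_const_def ..
  then show ?thesis
    by (intro that[of n]) (simp add: agree_iff_prefix[of m])
qed

text \<open>The first \<open>n\<close> coordinates determine the value, so the boolean lists of
  length \<open>n\<close>, padded with \<open>False\<close>, already give the whole range.\<close>

lemma finite_range_loc_const:
  assumes "loc_const p"
  shows "finite (range p)"
proof -
  obtain n where n: "\<forall>x y. agree n x y \<longrightarrow> p x = p y"
    using assms unfolding loc_const_def ..
  have "p x \<in> (\<lambda>l. p (\<lambda>i. i < n \<and> l ! i)) ` {l. set l \<subseteq> UNIV \<and> length l = n}" for x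
    by (rule image_eqI[of _ _ "map x [0..<n]"]) (auto intro!: n[rule_format] simp: agree_def)
  then have "range p \<subseteq> (\<lambda>l. p (\<lambda>i. i < n \<and> l ! i)) ` {l. set l \<subseteq> UNIV \<and> length l = n}"
    by (rule image_subsetI)
  then show ?thesis
    by (rule finite_subset) (intro finite_imageI finite_lists_length_eq, simp)
qed

section \<open>Clopen sets as generators of the Borel sets, and labels for disjoint families\<close>

lemma clopen_Int: "clopen A \<Longrightarrow> clopen B \<Longrightarrow> clopen (A \<inter> B)"
  by (auto simp: clopen_def)

lemma clopen_Diff: "clopen A \<Longrightarrow> clopen B \<Longrightarrow> clopen (A - B)"
  by (auto simp: clopen_def)

lemma clopen_empty [simp]: "clopen {}"
  by (simp add: clopen_def)

lemma clopen_UNIV [simp]: "clopen UNIV"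
  by (simp add: clopen_def)

lemma clopen_UN: "finite I \<Longrightarrow> (\<And>i. i \<in> I \<Longrightarrow> clopen (A i)) \<Longrightarrow> clopen (\<Union>i\<in>I. A i)"
  by (auto simp: clopen_def intro: closed_UN)

lemma clopen_continuous_vimage:
  "continuous_on UNIV f \<Longrightarrow> clopen S \<Longrightarrow> clopen (f -` S)"
  by (auto simp: clopen_def intro: open_vimage closed_vimage)

text \<open>An open set is the countable union, over \<open>n\<close>, of the clopen sets of points
  whose cylinder of depth \<open>n\<close> it contains. Hence measure preservation can be tested on
  clopen sets.\<close>

lemma sets_borel_cantor: "sets (borel :: cantor measure) = sigma_sets UNIV {U. clopen U}"
proof (rule antisym)
  have "U \<in> sigma_sets UNIV {U. clopen U}" if "open U" for U :: "cantor set"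
  proof -
    define A where "A n = {x. \<forall>y. agree n x y \<longrightarrow> y \<in> U}" for n
    have "loc_const (\<lambda>x. \<forall>y. agree n x y \<longrightarrow> y \<in> U)" for n
      unfolding loc_const_def
    proof (intro exI[of _ n] allI impI iffI)
      fix x z y assume "agree n x z"
      show "y \<in> U" if "\<forall>y. agree n x y \<longrightarrow> y \<in> U" "agree n z y"
        using that agree_trans[OF \<open>agree n x z\<close>] by simp
      show "y \<in> U" if "\<forall>y. agree n z y \<longrightarrow> y \<in> U" "agree n x y"
        using that agree_trans[OF agree_sym[OF \<open>agree n x z\<close>]] by simp
    qed
    then have "A n \<in> {U. clopen U}" for n
      unfolding A_def by (simp add: clopen_Collect)
    then have "(\<Union>n. A n) \<in> sigma_sets UNIV {U. clopen U}"
      by (intro sigma_sets.Union sigma_sets.Basic)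
    also have "(\<Union>n. A n) = U"
    proof
      show "(\<Union>n. A n) \<subseteq> U"
        unfolding A_def by (auto intro: agree_refl)
      show "U \<subseteq> (\<Union>n. A n)"
        using \<open>open U\<close> unfolding A_def open_cantor_iff by auto
    qed
    finally show ?thesis .
  qed
  then show "sets (borel :: cantor measure) \<subseteq> sigma_sets UNIV {U. clopen U}"
    using sigma_sets_mono[of "{U. open U}"] unfolding sets_borel by blast
  show "sigma_sets UNIV {U. clopen U} \<subseteq> sets (borel :: cantor measure)"
  proof -
    have "{U. clopen U} \<subseteq> sets (borel :: cantor measure)"
      by (auto simp: clopen_def)
    from sets.sigma_sets_subset[OF this] show ?thesis
      by simp
  qed
qed

lemma loc_const_family:
  assumes "finite I" "\<And>i. i \<in> I \<Longrightarrow> clopen (A i)"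
  shows "loc_const (\<lambda>x. {i \<in> I. x \<in> A i})"
  using assms
proof (induction I rule: finite_induct)
  case (insert j I)
  have "loc_const (\<lambda>x. if x \<in> A j then Set.insert j {i \<in> I. x \<in> A i} else {i \<in> I. x \<in> A i})"
    using insert loc_const_comp2[of "\<lambda>x. x \<in> A j" _ "\<lambda>b S. if b then Set.insert j S else S"]
    by (simp add: clopen_iff_loc_const)
  also have "(\<lambda>x. if x \<in> A j then Set.insert j {i \<in> I. x \<in> A i} else {i \<in> I. x \<in> A i}) =
      (\<lambda>x. {i \<in> Set.insert j I. x \<in> A i})"
    by (auto simp: fun_eq_iff)
  finally show ?case .
qed simp

text \<open>Replaces a disjoint clopen family by one index function. Off the union of the family its
  value is the unspecified \<open>the_elem {}\<close>.\<close>

lemma loc_const_label: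
  assumes "finite I" "\<And>i. i \<in> I \<Longrightarrow> clopen (A i)" "disjoint_family_on A I"
  obtains t where "loc_const t" "\<forall>i\<in>I. \<forall>x\<in>A i. t x = i"
proof
  show "loc_const (\<lambda>x. the_elem {i \<in> I. x \<in> A i})"
    by (rule loc_const_comp[OF loc_const_family[OF assms(1,2)]])
  show "\<forall>i\<in>I. \<forall>x\<in>A i. the_elem {i \<in> I. x \<in> A i} = i"
  proof (intro ballI)
    fix i x assume "i \<in> I" "x \<in> A i"
    then have "{i \<in> I. x \<in> A i} = {i}"
      using assms(3) by (auto simp: disjoint_family_on_def)
    then show "the_elem {i \<in> I. x \<in> A i} = i"
      by simp
  qed
qed

subsection \<open>Orbits and towers\<close>

text \<open>By pigeonhole the orbit of \<open>i0\<close> returns to some \<open>i\<close>. If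
  \<open>l\<close> is the least return time of \<open>i\<close>, the first \<open>l\<close> points
  are distinct: a coincidence at \<open>a < b < l\<close> would bring \<open>i\<close> back after
  \<open>l - b + a < l\<close> steps.\<close>

lemma finite_self_map_cycle:
  assumes "finite J" "i0 \<in> J" "\<And>i. i \<in> J \<Longrightarrow> \<sigma> i \<in> J"
  obtains i l where "i \<in> J" "0 < l" "(\<sigma> ^^ l) i = i" "inj_on (\<lambda>a. (\<sigma> ^^ a) i) {..<l}"
proof -
  have iter: "(\<sigma> ^^ n) i0 \<in> J" for n
    by (induction n) (simp_all add: assms)
  have "\<not> inj_on (\<lambda>n. (\<sigma> ^^ n) i0) {..card J}"
  proof
    assume "inj_on (\<lambda>n. (\<sigma> ^^ n) i0) {..card J}"
    then have "card {..card J} \<le> card J"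
      using iter by (intro card_inj_on_le[OF _ _ assms(1)]) auto
    then show False by simp
  qed
  then obtain m n where mn: "m < n" "(\<sigma> ^^ m) i0 = (\<sigma> ^^ n) i0"
    unfolding inj_on_def by (metis linorder_neqE_nat)
  define i where "i = (\<sigma> ^^ m) i0"
  have "(\<sigma> ^^ (n - m)) i = (\<sigma> ^^ (n - m + m)) i0"
    unfolding i_def funpow_add by simp
  then have ret: "0 < n - m \<and> (\<sigma> ^^ (n - m)) i = i"
    using mn by (simp add: i_def)
  define l where "l = (LEAST l. 0 < l \<and> (\<sigma> ^^ l) i = i)"
  have l: "0 < l \<and> (\<sigma> ^^ l) i = i"
    unfolding l_def using ret by (rule LeastI)
  have minimal: "l \<le> k" if "0 < k" "(\<sigma> ^^ k) i = i" for k
    unfolding l_def using that by (intro Least_le) simp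
  have False if "a < b" "b < l" "(\<sigma> ^^ a) i = (\<sigma> ^^ b) i" for a b
  proof -
    have "(\<sigma> ^^ (l - b + a)) i = (\<sigma> ^^ (l - b + b)) i"
      unfolding funpow_add comp_apply that(3) ..
    also have "\<dots> = i"
      using l that(2) by simp
    finally show False
      using minimal[of "l - b + a"] that(1,2) by simp
  qed
  then have "inj_on (\<lambda>a. (\<sigma> ^^ a) i) {..<l}"
    by (intro linorder_inj_onI') auto
  then show ?thesis
    using iter l by (intro that[of i l]) (simp_all add: i_def)
qed

lemma tower_funpow:
  assumes "\<And>x. t (f x) = Suc (t x) mod N" "\<And>x. t x < (N::nat)"
  shows "t ((f ^^ j) x) = (t x + j) mod N"
  by (induction j) (simp_all add: assms mod_Suc_eq)

text \<open>Climbing \<open>N - t x\<close> levels from \<open>x\<close> wraps around to level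
  \<open>0\<close>; there \<open>g\<close> crosses to the other tower, and \<open>f' ^^ t x\<close>
  climbs back to the original level. So \<open>\<phi>\<close> preserves levels, and the symmetric
  formula for \<open>\<psi>\<close> retraces the path.\<close>

lemma tower_conjugator_inverse:
  assumes f: "\<And>x. t (f x) = Suc (t x) mod N" "\<And>x. t x < N" "f ^^ N = id"
    and f': "\<And>x. t' (f' x) = Suc (t' x) mod N" "\<And>x. t' x < N" "f' ^^ N = id"
    and g: "\<And>x. t x = 0 \<Longrightarrow> t' (g x) = 0" "\<And>x. g' (g x) = x"
    and \<phi>: "\<And>x. \<phi> x = (f' ^^ t x) (g ((f ^^ (N - t x)) x))"
    and \<psi>: "\<And>y. \<psi> y = (f ^^ t' y) (g' ((f' ^^ (N - t' y)) y))"
  shows "\<psi> (\<phi> x) = x"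
proof -
  define z where "z = (f ^^ (N - t x)) x"
  have "t z = 0"
    using f(2)[of x] unfolding z_def by (subst tower_funpow[of t f N, OF f(1,2)]) simp
  then have "t' (g z) = 0"
    by (rule g(1))
  then have t': "t' (\<phi> x) = t x"
    unfolding \<phi> z_def[symmetric] using f(2)[of x] by (subst tower_funpow[of t' f' N, OF f'(1,2)]) simp
  have "(f' ^^ (N - t x)) (\<phi> x) = (f' ^^ (N - t x + t x)) (g z)"
    unfolding \<phi> z_def funpow_add by simp
  also have "\<dots> = g z"
    using f(2)[of x] f'(3) by simp
  finally have "\<psi> (\<phi> x) = (f ^^ (t x + (N - t x))) x"
    unfolding \<psi> t' funpow_add by (simp add: g(2) z_def)
  also have "\<dots> = x"
    using f(2)[of x] f(3) by simp
  finally show ?thesis .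
qed

subsection \<open>Measure-preserving homeomorphisms\<close>

locale good_cantor =
  fixes \<mu> :: "cantor measure"
  assumes good: "good_measure \<mu>"
begin

sublocale prob_space \<mu>
  using good by (simp add: good_measure_def full_measure_def borel_prob_def)

lemma sets_mu: "sets \<mu> = sets borel"
  using good by (simp add: good_measure_def full_measure_def borel_prob_def)

lemma space_mu [simp]: "space \<mu> = UNIV"
  using sets_eq_imp_space_eq[OF sets_mu] by simp

lemma clopen_sets: "clopen U \<Longrightarrow> U \<in> sets \<mu>"
  by (simp add: sets_mu clopen_def)

lemma prob_Diff_clopen:
  "clopen A \<Longrightarrow> clopen B \<Longrightarrow> B \<subseteq> A \<Longrightarrow> prob (A - B) = prob A - prob B"
  by (simp add: finite_measure_Diff clopen_sets)

lemma prob_mono_clopen: "clopen B \<Longrightarrow> A \<subseteq> B \<Longrightarrow> prob A \<le> prob B"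
  by (simp add: finite_measure_mono clopen_sets)

lemma prob_UN_clopen:
  assumes "finite I" "\<And>i. i \<in> I \<Longrightarrow> clopen (A i)" "disjoint_family_on A I"
  shows "prob (\<Union>i\<in>I. A i) = (\<Sum>i\<in>I. prob (A i))"
  using assms by (intro finite_measure_finite_Union) (auto intro: clopen_sets)

lemma prob_decompose:
  assumes "clopen S" "loc_const p" "finite I" "\<And>x. x \<in> S \<Longrightarrow> p x \<in> I"
  shows "prob S = (\<Sum>i\<in>I. prob (S \<inter> p -` {i}))"
proof -
  have "prob (\<Union>i\<in>I. S \<inter> p -` {i}) = (\<Sum>i\<in>I. prob (S \<inter> p -` {i}))"
    using assms
    by (intro prob_UN_clopen) (auto simp: disjoint_family_on_def intro: clopen_Int clopen_vimage_loc_const)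
  also have "(\<Union>i\<in>I. S \<inter> p -` {i}) = S"
    using assms(4) by auto
  finally show ?thesis .
qed

lemma prob_open_pos: "open U \<Longrightarrow> x \<in> U \<Longrightarrow> prob U > 0"
  using good by (auto simp: good_measure_def full_measure_def)

lemma clopen_null: "clopen U \<Longrightarrow> prob U = 0 \<Longrightarrow> U = {}"
  using prob_open_pos[of U] by (fastforce simp: clopen_def)

lemma prob_in_values: "clopen U \<Longrightarrow> prob U \<in> clopen_values \<mu>"
  by (auto simp: clopen_values_def)

text \<open>Goodness treats strict inequality; in the case of equality \<open>W\<close> itself
  serves.\<close>

lemma clopen_subset_prob:
  assumes "clopen W" "v \<in> clopen_values \<mu>" "v \<le> prob W"
  shows "\<exists>W'. clopen W' \<and> W' \<subseteq> W \<and> prob W' = v"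
proof (cases "v = prob W")
  case True
  then show ?thesis using assms(1) by blast
next
  case False
  obtain U where U: "clopen U" "v = prob U"
    using assms(2) by (auto simp: clopen_values_def)
  then have "prob U < prob W"
    using False assms(3) by simp
  then show ?thesis
    using good assms(1) U by (auto simp: good_measure_def)
qed

section \<open>The group of measure-preserving homeomorphisms\<close>

abbreviation G :: "(cantor \<Rightarrow> cantor) set" where
  "G \<equiv> carrier (Homeo \<mu>)"

text \<open>For the converse, a continuous bijection from a compact space to a Hausdorff space is a
  homeomorphism, and two finite measures that agree on the intersection-stable generator of clopen
  sets are equal.\<close>

lemma G_iff:
  "f \<in> G \<longleftrightarrow> bij f \<and> continuous_on UNIV f \<and> (\<forall>S. clopen S \<longrightarrow> prob (f -` S) = prob S)"
proof
  assume "f \<in> G"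
  then have h: "homeomorphic_map euclidean euclidean f" and d: "distr \<mu> \<mu> f = \<mu>"
    by (auto simp: Homeo_def)
  have b: "bij f"
    using homeomorphic_imp_injective_map[OF h] homeomorphic_imp_surjective_map[OF h]
    by (simp add: bij_def)
  have c: "continuous_on UNIV f"
    using homeomorphic_imp_continuous_map[OF h] by simp
  then have meas: "f \<in> measurable \<mu> \<mu>"
    using borel_measurable_continuous_onI measurable_cong_sets[OF sets_mu sets_mu] by blast
  have "prob (f -` S) = prob S" if "clopen S" for S
    using measure_distr[OF meas clopen_sets[OF that]] d by simp
  with b c show "bij f \<and> continuous_on UNIV f \<and> (\<forall>S. clopen S \<longrightarrow> prob (f -` S) = prob S)"
    by blast
next
  assume *: "bij f \<and> continuous_on UNIV f \<and> (\<forall>S. clopen S \<longrightarrow> prob (f -` S) = prob S)"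
  have "\<exists>U V :: bool set. open U \<and> open V \<and> x \<in> U \<and> y \<in> V \<and> disjnt U V" if "x \<noteq> y" for x y
    using that by (intro exI[of _ "{x}"] exI[of _ "{y}"]) (auto simp: open_discrete)
  then have "Hausdorff_space (euclidean :: bool topology)"
    by (simp add: Hausdorff_space_def)
  then have "Hausdorff_space (product_topology (\<lambda>i::nat. euclidean::bool topology) UNIV)"
    by (simp add: Hausdorff_space_product_topology)
  then have "Hausdorff_space (euclidean :: cantor topology)"
    by (simp only: euclidean_product_topology)
  then have h: "homeomorphic_map euclidean euclidean f"
    using * compact_cantor
    by (intro continuous_imp_homeomorphic_map) (simp_all add: bij_def compact_space_def)
  have meas: "f \<in> measurable \<mu> \<mu>"
    using * borel_measurable_continuous_onI measurable_cong_sets[OF sets_mu sets_mu] by blast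
  have "distr \<mu> \<mu> f = \<mu>"
  proof (rule measure_eqI_generator_eq[where E = "{U. clopen U}" and \<Omega> = UNIV and A = "\<lambda>_. UNIV"])
    show "Int_stable {U :: cantor set. clopen U}"
      by (auto simp: Int_stable_def intro: clopen_Int)
    show "emeasure (distr \<mu> \<mu> f) X = emeasure \<mu> X" if "X \<in> {U. clopen U}" for X
      using that * by (simp add: emeasure_distr[OF meas] clopen_sets emeasure_eq_measure)
    show "sets (distr \<mu> \<mu> f) = sigma_sets UNIV {U. clopen U}" "sets \<mu> = sigma_sets UNIV {U. clopen U}"
      by (simp_all add: sets_mu sets_borel_cantor)
    show "emeasure (distr \<mu> \<mu> f) UNIV \<noteq> \<infinity>"
      by (simp add: emeasure_distr[OF meas] clopen_sets emeasure_eq_measure)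
  qed auto
  with h show "f \<in> G"
    by (simp add: Homeo_def)
qed

lemma G_bij: "f \<in> G \<Longrightarrow> bij f"
  and G_continuous: "f \<in> G \<Longrightarrow> continuous_on UNIV f"
  and G_prob: "f \<in> G \<Longrightarrow> clopen S \<Longrightarrow> prob (f -` S) = prob S"
  by (auto simp: G_iff)

lemma G_id: "id \<in> G"
  using group.is_monoid[OF group_Homeo[OF sets_mu], THEN monoid.one_closed]
  by (simp add: Homeo_def)

lemma G_comp: "f \<in> G \<Longrightarrow> g \<in> G \<Longrightarrow> f \<circ> g \<in> G"
  using group.is_monoid[OF group_Homeo[OF sets_mu], THEN monoid.m_closed, of f g]
  by (simp add: Homeo_def)

lemma inv_Homeo:
  assumes "f \<in> G"
  shows "inv\<^bsub>Homeo \<mu>\<^esub> f = inv_into UNIV f" and "inv_into UNIV f \<in> G"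
proof -
  interpret group "Homeo \<mu>"
    by (rule group_Homeo[OF sets_mu])
  have "inv\<^bsub>Homeo \<mu>\<^esub> f \<otimes>\<^bsub>Homeo \<mu>\<^esub> f = \<one>\<^bsub>Homeo \<mu>\<^esub>"
    using assms by (rule l_inv)
  then have "inv\<^bsub>Homeo \<mu>\<^esub> f \<circ> f = id"
    by (simp add: Homeo_def)
  then show *: "inv\<^bsub>Homeo \<mu>\<^esub> f = inv_into UNIV f"
    by (metis G_bij assms bij_is_surj comp_assoc comp_id id_comp surj_iff)
  show "inv_into UNIV f \<in> G"
    using inv_closed[OF assms] by (simp add: *)
qed

lemma G_funpow: "f \<in> G \<Longrightarrow> f ^^ n \<in> G"
  by (induction n) (simp_all add: G_id G_comp)

lemma inv_apply [simp]: "f \<in> G \<Longrightarrow> inv_into UNIV f (f x) = x" "f \<in> G \<Longrightarrow> f (inv_into UNIV f x) = x"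
  using G_bij[of f] by (simp_all add: bij_is_inj bij_is_surj surj_f_inv_f)

lemma G_prob_image:
  assumes "f \<in> G" "clopen S"
  shows "prob (f ` S) = prob S"
proof -
  have "f ` S = inv_into UNIV f -` S"
    using assms(1) by (simp add: bij_vimage_eq_inv_image bij_imp_bij_inv G_bij inv_inv_eq)
  then show ?thesis
    using G_prob[OF inv_Homeo(2)[OF assms(1)] assms(2)] by simp
qed

lemma loc_const_G: "f \<in> G \<Longrightarrow> loc_const p \<Longrightarrow> loc_const (\<lambda>x. p (f x))"
  by (rule loc_const_vimage[OF G_continuous])

text \<open>Piecewise construction of group elements. On each piece of the finite partition given by
  \<open>p\<close> the map coincides with an element of \<open>G\<close>. To compare the measures of
  \<open>S\<close> and its preimage, the preimage is cut along \<open>p\<close>; the images of the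
  parts partition \<open>S\<close> by bijectivity.\<close>

lemma glue_in_G:
  assumes p: "loc_const p" and g: "\<And>x. g (p x) \<in> G" and b: "bij (\<lambda>x. g (p x) x)"
  shows "(\<lambda>x. g (p x) x) \<in> G"
  unfolding G_iff
proof (intro conjI allI impI)
  define F where "F x = g (p x) x" for x
  have fin: "finite (range p)"
    by (rule finite_range_loc_const[OF p])
  have lc: "loc_const (\<lambda>x. q (F x))" if q: "loc_const q" for q :: "cantor \<Rightarrow> 'z"
  proof (rule loc_constI)
    fix a
    have "(\<lambda>x. q (F x)) -` {a} = (\<Union>i\<in>range p. p -` {i} \<inter> (\<lambda>x. q (g i x)) -` {a})"
      by (auto simp: F_def)
    also have "open \<dots>"
    proof (intro open_UN ballI open_Int)
      fix i assume "i \<in> range p"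
      then have "g i \<in> G" using g by auto
      then show "open ((\<lambda>x. q (g i x)) -` {a})"
        by (intro open_vimage_loc_const loc_const_G[OF _ q])
    qed (rule open_vimage_loc_const[OF p])
    finally show "open ((\<lambda>x. q (F x)) -` {a})" .
  qed
  show "continuous_on UNIV (\<lambda>x. g (p x) x)"
    using lc[OF loc_const_coord] by (intro continuous_cantorI) (simp add: F_def)
  fix S :: "cantor set" assume S: "clopen S"
  have clF: "clopen (F -` S)"
    using lc[OF S[unfolded clopen_iff_loc_const]] by (simp add: clopen_iff_loc_const)
  have img: "F ` (F -` S \<inter> p -` {i}) = g i ` (F -` S \<inter> p -` {i})" for i
    by (auto simp: F_def image_iff)
  have cl: "clopen (F -` S \<inter> p -` {i})" for i
    by (intro clopen_Int clF clopen_vimage_loc_const p)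
  have clg: "clopen (g i ` (F -` S \<inter> p -` {i}))" if "i \<in> range p" for i
  proof -
    have gi: "g i \<in> G" using that g by auto
    have "g i ` A = inv_into UNIV (g i) -` A" for A
      using gi by (simp add: bij_vimage_eq_inv_image bij_imp_bij_inv G_bij inv_inv_eq)
    then show ?thesis
      using clopen_continuous_vimage[OF G_continuous[OF inv_Homeo(2)[OF gi]] cl] by simp
  qed
  have bF: "bij F"
    using b by (simp add: F_def[abs_def])
  have "prob (F -` S) = (\<Sum>i\<in>range p. prob (F -` S \<inter> p -` {i}))"
    by (rule prob_decompose[OF clF p fin]) simp
  also have "\<dots> = (\<Sum>i\<in>range p. prob (F ` (F -` S \<inter> p -` {i})))"
    unfolding img using g by (intro sum.cong refl) (auto simp: G_prob_image cl)
  also have "\<dots> = prob (\<Union>i\<in>range p. F ` (F -` S \<inter> p -` {i}))"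
  proof (rule prob_UN_clopen[symmetric, OF fin])
    show "clopen (F ` (F -` S \<inter> p -` {i}))" if "i \<in> range p" for i
      unfolding img by (rule clg[OF that])
    show "disjoint_family_on (\<lambda>i. F ` (F -` S \<inter> p -` {i})) (range p)"
      unfolding disjoint_family_on_def image_Int[OF bij_is_inj[OF bF], symmetric] by auto
  qed
  also have "(\<Union>i\<in>range p. F ` (F -` S \<inter> p -` {i})) = F ` (F -` S)"
    by (subst image_UN[symmetric], rule arg_cong[where f = "image F"]) auto
  also have "\<dots> = S"
    by (rule surj_image_vimage_eq[OF bij_is_surj[OF bF]])
  finally show "prob ((\<lambda>x. g (p x) x) -` S) = prob S"
    by (simp add: F_def[abs_def])
qed (rule b)

subsection \<open>Homogeneity of good measures\<close>

text \<open>Greedy choice: the part of \<open>D\<close> not yet taken has measure at least the next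
  value, so goodness provides the next set inside it.\<close>

lemma disjoint_clopens:
  assumes "clopen D" "finite I"
    and "\<And>i. i \<in> I \<Longrightarrow> v i \<in> clopen_values \<mu>" and "(\<Sum>i\<in>I. v i) \<le> prob D"
  shows "\<exists>A. (\<forall>i\<in>I. clopen (A i) \<and> A i \<subseteq> D \<and> prob (A i) = v i) \<and> disjoint_family_on A I"
  using assms(2-4)
proof (induction I rule: finite_induct)
  case empty
  then show ?case by (simp add: disjoint_family_on_def)
next
  case (insert j I)
  have "0 \<le> v j"
    using insert.prems(1)[of j] by (auto simp: clopen_values_def)
  then have "(\<Sum>i\<in>I. v i) \<le> prob D"
    using insert by simp
  then obtain A where A: "\<forall>i\<in>I. clopen (A i) \<and> A i \<subseteq> D \<and> prob (A i) = v i"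
    and disj: "disjoint_family_on A I"
    using insert.IH insert.prems(1) by auto
  have clU: "clopen (\<Union>i\<in>I. A i)"
    using A insert.hyps(1) by (intro clopen_UN) auto
  have "(\<Union>i\<in>I. A i) \<subseteq> D"
    using A by auto
  then have "prob (D - (\<Union>i\<in>I. A i)) = prob D - prob (\<Union>i\<in>I. A i)"
    by (intro prob_Diff_clopen assms(1) clU)
  also have "prob (\<Union>i\<in>I. A i) = (\<Sum>i\<in>I. v i)"
    using A insert.hyps(1) disj by (subst prob_UN_clopen) auto
  finally have "v j \<le> prob (D - (\<Union>i\<in>I. A i))"
    using insert.prems(2) insert.hyps by simp
  then obtain W where W: "clopen W" "W \<subseteq> D - (\<Union>i\<in>I. A i)" "prob W = v j"
    using clopen_subset_prob[OF clopen_Diff[OF assms(1) clU], of "v j"] insert.prems(1)[of j] by auto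
  have "disjoint_family_on (A(j := W)) (insert j I)"
    using disj W(2) insert.hyps(2) by (auto simp: disjoint_family_on_def)
  moreover have "\<forall>i\<in>insert j I. clopen ((A(j := W)) i) \<and> (A(j := W)) i \<subseteq> D \<and> prob ((A(j := W)) i) = v i"
    using A W by auto
  ultimately show ?case
    by blast
qed

text \<open>A finite stage of the back-and-forth: fibres of \<open>p\<close> and \<open>q\<close>
  with the same label are to be matched, and have equal measure.\<close>

definition balanced :: "(cantor \<Rightarrow> 'a) \<Rightarrow> (cantor \<Rightarrow> 'a) \<Rightarrow> bool" where
  "balanced p q \<longleftrightarrow> loc_const p \<and> loc_const q \<and> (\<forall>l. prob (p -` {l}) = prob (q -` {l}))"

lemma balanced_sym: "balanced p q \<Longrightarrow> balanced q p"
  by (simp add: balanced_def)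

lemma balanced_prob_vimage:
  assumes "balanced p q"
  shows "prob (p -` J) = prob (q -` J)"
proof -
  have lc: "loc_const p" "loc_const q" and eq: "prob (p -` {i}) = prob (q -` {i})" for i
    using assms by (simp_all add: balanced_def)
  define I where "I = range p \<union> range q"
  have "finite I"
    using lc by (simp add: I_def finite_range_loc_const)
  have int: "r -` J \<inter> r -` {i} = (if i \<in> J then r -` {i} else {})" for r :: "cantor \<Rightarrow> 'a" and i
    by auto
  have "prob (p -` J) = (\<Sum>i\<in>I. prob (p -` J \<inter> p -` {i}))"
    by (intro prob_decompose clopen_vimage_loc_const lc \<open>finite I\<close>) (simp add: I_def)
  also have "\<dots> = (\<Sum>i\<in>I. prob (q -` J \<inter> q -` {i}))"
    unfolding int by (intro sum.cong) (auto simp: eq)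
  also have "\<dots> = prob (q -` J)"
    by (intro prob_decompose[symmetric] clopen_vimage_loc_const lc \<open>finite I\<close>) (simp add: I_def)
  finally show ?thesis .
qed

text \<open>Half a step of the back-and-forth: \<open>U\<close> cuts each fibre of \<open>p\<close>,
  and goodness cuts a part of the same measure from the fibre of \<open>q\<close> with the same
  label.\<close>

lemma balanced_refine:
  fixes p q :: "cantor \<Rightarrow> bool list"
  assumes bal: "balanced p q" and U: "clopen U"
  shows "\<exists>U'. balanced (\<lambda>x. (x \<in> U) # p x) (\<lambda>x. (x \<in> U') # q x)"
proof -
  have lc: "loc_const p" "loc_const q" and eq: "prob (p -` {l}) = prob (q -` {l})" for l
    using bal by (simp_all add: balanced_def)
  have cl: "clopen (p -` {l})" "clopen (q -` {l})" for l
    by (intro clopen_vimage_loc_const lc)+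
  have "\<exists>W. clopen W \<and> W \<subseteq> q -` {l} \<and> prob W = prob (p -` {l} \<inter> U)" for l
  proof (rule clopen_subset_prob[OF cl(2)])
    show "prob (p -` {l} \<inter> U) \<in> clopen_values \<mu>"
      by (intro prob_in_values clopen_Int cl U)
    show "prob (p -` {l} \<inter> U) \<le> prob (q -` {l})"
      unfolding eq[symmetric] by (intro prob_mono_clopen cl) auto
  qed
  then obtain W where W: "\<And>l. clopen (W l)" "\<And>l. W l \<subseteq> q -` {l}"
    "\<And>l. prob (W l) = prob (p -` {l} \<inter> U)"
    by metis
  define U' where "U' = (\<Union>l\<in>range p. W l)"
  have U': "clopen U'"
    unfolding U'_def by (intro clopen_UN finite_range_loc_const lc W)
  have q_W: "q y = l" if "y \<in> W l" for y l
    using W(2)[of l] that by auto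
  have U'_int: "prob (q -` {l} \<inter> U') = prob (p -` {l} \<inter> U)" for l
  proof (cases "l \<in> range p")
    case True
    then have "q -` {l} \<inter> U' = W l"
      unfolding U'_def by (auto dest: q_W) (metis q_W)
    then show ?thesis by (simp add: W(3))
  next
    case False
    \<comment> \<open>For a label that \<open>p\<close> does not take, the fibre of \<open>q\<close>
      is null, hence empty by fullness.\<close>
    then have p: "p -` {l} = {}"
      by auto
    then have "q -` {l} = {}"
      using eq[of l] by (intro clopen_null cl) simp
    with p show ?thesis by simp
  qed
  have diff: "prob (r -` {l} - S) = prob (r -` {l}) - prob (r -` {l} \<inter> S)"
    if "loc_const r" "clopen S" for r :: "cantor \<Rightarrow> bool list" and l S
    using that by (intro finite_measure_Diff' clopen_sets clopen_vimage_loc_const)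
  have "balanced (\<lambda>x. (x \<in> U) # p x) (\<lambda>x. (x \<in> U') # q x)"
    unfolding balanced_def
  proof (intro conjI allI)
    show "loc_const (\<lambda>x. (x \<in> U) # p x)"
      by (rule loc_const_comp2[OF U[unfolded clopen_iff_loc_const] lc(1)])
    show "loc_const (\<lambda>x. (x \<in> U') # q x)"
      by (rule loc_const_comp2[OF U'[unfolded clopen_iff_loc_const] lc(2)])
    have vim: "(\<lambda>x. (x \<in> S) # r x) -` {b # l} = (if b then r -` {l} \<inter> S else r -` {l} - S)"
      for S and r :: "cantor \<Rightarrow> bool list" and b l
      by auto
    fix l
    show "prob ((\<lambda>x. (x \<in> U) # p x) -` {l}) = prob ((\<lambda>x. (x \<in> U') # q x) -` {l})"
      by (cases l) (simp_all add: vim diff lc U U' U'_int eq, simp add: vimage_def)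
  qed
  then show ?thesis ..
qed

text \<open>
  The first new bit on the \<open>q\<close> side and the second new bit on the \<open>p\<close> side record coordinate \<open>k\<close>: in the
  limit both label sequences separate points.
\<close>

lemma balanced_step:
  fixes p q :: "cantor \<Rightarrow> bool list"
  assumes "balanced p q"
  obtains p' q' :: "cantor \<Rightarrow> bool list" where "balanced p' q'"
    "\<forall>x. p x = tl (tl (p' x))" "\<forall>y. q y = tl (tl (q' y))"
    "\<forall>x. x k = hd (tl (p' x))" "\<forall>y. y k = hd (q' y)"
proof -
  define C where "C = {x :: cantor. x k}"
  have C: "clopen C"
    unfolding C_def by (intro clopen_Collect loc_const_coord)
  obtain U where U: "balanced (\<lambda>x. (x \<in> C) # p x) (\<lambda>y. (y \<in> U) # q y)"
    using balanced_refine[OF assms C] by blast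
  obtain U' where U': "balanced (\<lambda>y. (y \<in> C) # (y \<in> U) # q y) (\<lambda>x. (x \<in> U') # (x \<in> C) # p x)"
    using balanced_refine[OF balanced_sym[OF U] C] by blast
  show ?thesis
    by (rule that[OF balanced_sym[OF U']]) (simp_all add: C_def)
qed

text \<open>Dependent choice over \<open>balanced_step\<close>. Each stage puts two bits in front of
  the labels, so two applications of \<open>tl\<close> recover the stage before.\<close>

lemma balanced_chain:
  fixes p0 q0 :: "cantor \<Rightarrow> bool list"
  assumes "balanced p0 q0"
  obtains p q :: "nat \<Rightarrow> cantor \<Rightarrow> bool list" where "p 0 = p0" "q 0 = q0"
    "\<forall>k. balanced (p k) (q k)"
    "\<forall>k x. p k x = tl (tl (p (Suc k) x))" "\<forall>k y. q k y = tl (tl (q (Suc k) y))"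
    "\<forall>k x. x k = hd (tl (p (Suc k) x))" "\<forall>k y. y k = hd (q (Suc k) y)"
proof -
  \<comment> \<open>The clause for \<open>k = 0\<close> pins the start of the chain to the given
    pair.\<close>
  define P :: "nat \<Rightarrow> (cantor \<Rightarrow> bool list) \<times> (cantor \<Rightarrow> bool list) \<Rightarrow> bool"
    where "P k r \<longleftrightarrow> balanced (fst r) (snd r) \<and> (k = 0 \<longrightarrow> r = (p0, q0))" for k r
  define Q :: "nat \<Rightarrow> (cantor \<Rightarrow> bool list) \<times> (cantor \<Rightarrow> bool list)
      \<Rightarrow> (cantor \<Rightarrow> bool list) \<times> (cantor \<Rightarrow> bool list) \<Rightarrow> bool"
    where "Q k r s \<longleftrightarrow> (\<forall>x. fst r x = tl (tl (fst s x))) \<and> (\<forall>y. snd r y = tl (tl (snd s y))) \<and>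
      (\<forall>x. x k = hd (tl (fst s x))) \<and> (\<forall>y. y k = hd (snd s y))" for k r s
  have "\<exists>f. \<forall>k. P k (f k) \<and> Q k (f k) (f (Suc k))"
  proof (rule dependent_nat_choice)
    show "\<exists>r. P 0 r"
      using assms by (simp add: P_def)
    fix r k assume "P k r"
    then have "balanced (fst r) (snd r)" by (simp add: P_def)
    then obtain p' q' where "balanced p' q'"
      "\<forall>x. fst r x = tl (tl (p' x))" "\<forall>y. snd r y = tl (tl (q' y))"
      "\<forall>x. x k = hd (tl (p' x))" "\<forall>y. y k = hd (q' y)"
      by (rule balanced_step[of "fst r" "snd r" k])
    then show "\<exists>s. P (Suc k) s \<and> Q k r s"
      by (intro exI[of _ "(p', q')"]) (simp add: P_def Q_def)
  qed
  then obtain f where f: "\<forall>k. P k (f k) \<and> Q k (f k) (f (Suc k))" ..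
  then have "P 0 (f 0)"
    by blast
  then have f0: "fst (f 0) = p0" "snd (f 0) = q0"
    by (simp_all add: P_def)
  have bal: "\<forall>k. balanced (fst (f k)) (snd (f k))"
    using f unfolding P_def by blast
  have "Q k (f k) (f (Suc k))" for k
    using f by blast
  note Q = this[unfolded Q_def]
  show ?thesis
    by (rule that[of "\<lambda>k. fst (f k)" "\<lambda>k. snd (f k)", OF f0 bal]; intro allI)
      (rule Q[THEN conjunct1, rule_format] Q[THEN conjunct2, THEN conjunct1, rule_format]
        Q[THEN conjunct2, THEN conjunct2, THEN conjunct1, rule_format]
        Q[THEN conjunct2, THEN conjunct2, THEN conjunct2, rule_format])+
qed

text \<open>The fibres of \<open>q k\<close> over the labels of \<open>x\<close> are nested and
  closed. Each is nonempty, having the measure of the open fibre of \<open>p k\<close> around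
  \<open>x\<close>, which is positive by fullness. Compactness gives a common point.\<close>

lemma balanced_chain_partner:
  assumes bal: "\<And>k::nat. balanced (p k) (q k)"
    and p: "\<And>k x. p k x = F (p (Suc k) x)" and q: "\<And>k y. q k y = F (q (Suc k) y)"
  shows "\<exists>y. \<forall>k. q k y = p k x"
proof -
  have down: "q k y = p k x" if "q l y = p l x" "k \<le> l" for k l y
    using that(2,1) by (induction rule: inc_induct) (metis p q)+
  have lc: "loc_const (p k)" "loc_const (q k)" for k
    using bal by (simp_all add: balanced_def)
  have "UNIV \<inter> (\<Inter>k\<in>UNIV. q k -` {p k x}) \<noteq> {}"
  proof (rule compact_imp_fip_image[OF compact_cantor])
    show "closed (q k -` {p k x})" for k
      using clopen_vimage_loc_const[OF lc(2)] by (simp add: clopen_def)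
    fix I :: "nat set" assume "finite I"
    define l where "l = Max (insert 0 I)"
    have "0 < prob (p l -` {p l x})"
      by (rule prob_open_pos[OF open_vimage_loc_const[OF lc(1)]]) auto
    also have "\<dots> = prob (q l -` {p l x})"
      using bal by (simp add: balanced_def)
    finally have "q l -` {p l x} \<noteq> {}"
      by force
    then obtain y where y: "q l y = p l x"
      by auto
    have "q k y = p k x" if "k \<in> I" for k
      by (rule down[OF y]) (use \<open>finite I\<close> that in \<open>simp add: l_def\<close>)
    then show "UNIV \<inter> (\<Inter>k\<in>I. q k -` {p k x}) \<noteq> {}"
      by auto
  qed
  then show ?thesis
    by auto
qed

text \<open>Send \<open>x\<close> to a point carrying the same labels at all stages. The label
  sequences record every coordinate on both sides, so the partner maps in the two directions are
  mutually inverse. A clopen set is a union of fibres of some \<open>q n\<close>, so its preimage is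
  the matching union of fibres of \<open>p n\<close>, of equal measure.\<close>

lemma balanced_extend:
  fixes p0 q0 :: "cantor \<Rightarrow> bool list"
  assumes "balanced p0 q0"
  obtains h where "h \<in> G" "\<forall>x. q0 (h x) = p0 x"
proof -
  obtain p q :: "nat \<Rightarrow> cantor \<Rightarrow> bool list" where pq0: "p 0 = p0" "q 0 = q0"
    and chain: "\<forall>k. balanced (p k) (q k)"
      "\<forall>k x. p k x = tl (tl (p (Suc k) x))" "\<forall>k y. q k y = tl (tl (q (Suc k) y))"
      "\<forall>k x. x k = hd (tl (p (Suc k) x))" "\<forall>k y. y k = hd (q (Suc k) y)"
    using assms by (rule balanced_chain)
  note bal = chain(1)[rule_format] and p = chain(2)[rule_format] and q = chain(3)[rule_format]
    and cp = chain(4)[rule_format] and cq = chain(5)[rule_format]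
  have lc: "loc_const (p k)" "loc_const (q k)" for k
    using bal by (simp_all add: balanced_def)
  have "\<exists>y. \<forall>k. q k y = p k x" for x
    by (rule balanced_chain_partner[where F = "\<lambda>l. tl (tl l)" and p = p and q = q, OF bal p q])
  then obtain h where h: "\<And>x k. q k (h x) = p k x"
    by metis
  have "\<exists>x. \<forall>k. p k x = q k y" for y
    by (rule balanced_chain_partner[where F = "\<lambda>l. tl (tl l)" and p = q and q = p,
          OF balanced_sym[OF bal] q p])
  then obtain h' where h': "\<And>y k. p k (h' y) = q k y"
    by metis
  have "h' (h x) k = x k" for x k
    unfolding cp[of _ k] h' h ..
  then have inj: "inj h"
    by (intro inj_on_inverseI[of _ h']) auto
  have "h (h' y) k = y k" for y k
    unfolding cq[of _ k] h' h ..
  then have surj: "surj h"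
    by (intro surjI[of _ h']) auto
  have "h \<in> G"
    unfolding G_iff
  proof (intro conjI allI impI)
    show "bij h"
      using inj surj by (simp add: bij_def)
    have "loc_const (\<lambda>x. h x k)" for k
      unfolding cq[of _ k] h by (rule loc_const_comp[OF lc(1)])
    then show "continuous_on UNIV h"
      by (rule continuous_cantorI)
    fix S :: "cantor set" assume "clopen S"
    then obtain n where n: "\<forall>x y. agree n x y \<longrightarrow> (x \<in> S) = (y \<in> S)"
      unfolding clopen_iff_loc_const loc_const_def ..
    have down: "q k y = q k z" if "q l y = q l z" "k \<le> l" for k l y z
      using that(2,1) by (induction rule: inc_induct) (metis q)+
    have "agree n y z" if "q n y = q n z" for y z
      unfolding agree_def
    proof (intro allI impI)
      fix i assume "i < n"
      then have "q (Suc i) y = q (Suc i) z"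
        by (intro down[OF that]) simp
      then show "y i = z i"
        unfolding cq[of _ i] by simp
    qed
    then have S: "y \<in> S \<longleftrightarrow> q n y \<in> q n ` S" for y
      using n by (metis image_iff)
    have "h -` S = p n -` (q n ` S)"
      unfolding vimage_def S h ..
    moreover have "S = q n -` (q n ` S)"
      unfolding vimage_def S[symmetric] by simp
    ultimately show "prob (h -` S) = prob S"
      using balanced_prob_vimage[OF bal] by metis
  qed
  moreover have "\<forall>x. q0 (h x) = p0 x"
    using h[of 0] by (simp add: pq0)
  ultimately show ?thesis
    by (rule that)
qed

text \<open>Homogeneity: membership in \<open>U\<close> and in \<open>W\<close> are balanced one-bit
  labels, since the complements also have equal measure.\<close>

lemma exists_transport:
  assumes "clopen U" "clopen W" "prob U = prob W"
  obtains h where "h \<in> G" "\<forall>x. h x \<in> W \<longleftrightarrow> x \<in> U"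
proof -
  have vim: "(\<lambda>x. [x \<in> S]) -` {l} = (if l = [True] then S else if l = [False] then UNIV - S else {})"
    for S :: "cantor set" and l
    by auto
  have "balanced (\<lambda>x. [x \<in> U]) (\<lambda>x. [x \<in> W])"
    unfolding balanced_def vim
    using assms by (auto intro!: loc_const_comp[of _ "\<lambda>b. [b]"] simp: clopen_iff_loc_const[symmetric] prob_Diff_clopen)
  then obtain h where h: "h \<in> G" "\<forall>x. [h x \<in> W] = [x \<in> U]"
    by (rule balanced_extend)
  have "\<forall>x. h x \<in> W \<longleftrightarrow> x \<in> U"
    using h(2) by simp
  with h(1) show ?thesis
    by (rule that)
qed

subsection \<open>The topology of the homeomorphism group\<close>

lemma topspace_Homeo_topology: "topspace (Homeo_topology \<mu>) = G"
proof -
  have "UNIV \<in> {{f. f ` K \<subseteq> U} | (K :: cantor set) (U :: cantor set). compact K \<and> open U}"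
    by (rule CollectI, rule exI[of _ "{}"], rule exI[of _ UNIV]) simp
  then have "(\<Union>{{f. f ` K \<subseteq> U} | (K :: cantor set) (U :: cantor set). compact K \<and> open U}) = UNIV"
    by (intro top_le Union_upper)
  then show ?thesis
    by (auto simp: Homeo_topology_def compact_open_topology_def G_continuous)
qed

text \<open>The fibres of the label of \<open>f x\<close> to depth \<open>n\<close> are finitely
  many compact sets, and \<open>g\<close> agrees with \<open>f\<close> to that depth exactly when it
  sends each fibre into the matching cylinder: a finite intersection of subbasic sets.\<close>

lemma openin_Homeo_agree:
  assumes "f \<in> G"
  shows "openin (Homeo_topology \<mu>) {g \<in> G. \<forall>x. agree n (g x) (f x)}"
proof -
  define S where "S = {{f. f ` K \<subseteq> U} | (K :: cantor set) (U :: cantor set). compact K \<and> open U}"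
  define r where "r x = map x [0..<n]" for x :: cantor
  have lc: "loc_const r"
    unfolding r_def by (rule loc_const_prefix)
  have lcf: "loc_const (\<lambda>x. r (f x))"
    by (rule loc_const_G[OF assms lc])
  define T where "T l = {g. g ` ((\<lambda>x. r (f x)) -` {l}) \<subseteq> r -` {l}}" for l
  have "T l \<in> S" for l
    unfolding S_def T_def
    by (rule CollectI, rule exI[of _ "(\<lambda>x. r (f x)) -` {l}"], rule exI[of _ "r -` {l}"])
      (intro conjI refl compact_clopen clopen_vimage_loc_const lcf open_vimage_loc_const lc)
  then have "openin (topology_generated_by S) (T l)" for l
    by (rule topology_generated_by_Basis)
  then have "openin (topology_generated_by S) (\<Inter>l\<in>range (\<lambda>x. r (f x)). T l)"
    using finite_range_loc_const[OF lcf] by (intro openin_INT2) auto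
  moreover have "(\<forall>x. agree n (g x) (f x)) \<longleftrightarrow> (\<forall>l\<in>range (\<lambda>x. r (f x)). g \<in> T l)" for g
    unfolding T_def agree_iff_prefix r_def[symmetric] by blast
  then have "{g \<in> G. \<forall>x. agree n (g x) (f x)} =
      ((\<Inter>l\<in>range (\<lambda>x. r (f x)). T l) \<inter> {f. continuous_on UNIV f}) \<inter> G"
    using G_continuous by blast
  ultimately show ?thesis
    unfolding Homeo_topology_def compact_open_topology_def S_def[symmetric]
    by (auto simp: openin_subtopology)
qed

text \<open>Induction on the generation of open sets from the subbasis. For a subbasic set, the
  compact image of \<open>K\<close> under \<open>f\<close> has cylinders of one common depth inside
  \<open>U\<close>.\<close>

lemma openin_Homeo_agree_nhd:
  assumes "openin (Homeo_topology \<mu>) T" "f \<in> T"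
  shows "\<exists>n. \<forall>g\<in>G. (\<forall>x. agree n (g x) (f x)) \<longrightarrow> g \<in> T"
proof -
  define S where "S = {{f. f ` K \<subseteq> U} | (K :: cantor set) (U :: cantor set). compact K \<and> open U}"
  obtain T' where T': "generate_topology_on S T'" "T = (T' \<inter> {f. continuous_on UNIV f}) \<inter> G"
    using assms(1) unfolding Homeo_topology_def compact_open_topology_def S_def[symmetric]
    by (auto simp: openin_subtopology openin_topology_generated_by_iff)
  have f: "continuous_on UNIV f"
    using assms(2) T'(2) by auto
  have "\<exists>n. \<forall>g. (\<forall>x. agree n (g x) (f x)) \<longrightarrow> g \<in> T'" if "f \<in> T'"
    using T'(1) that
  proof (induction rule: generate_topology_on.induct)
    case (Int a b)
    then obtain m n where "\<forall>g. (\<forall>x. agree m (g x) (f x)) \<longrightarrow> g \<in> a"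
      "\<forall>g. (\<forall>x. agree n (g x) (f x)) \<longrightarrow> g \<in> b"
      by auto
    then have "\<forall>g. (\<forall>x. agree (max m n) (g x) (f x)) \<longrightarrow> g \<in> a \<inter> b"
      by (meson IntI agree_mono max.cobounded1 max.cobounded2)
    then show ?case ..
  next
    case (UN K)
    then show ?case by (meson UnionE UnionI)
  next
    case (Basis s)
    then obtain K U where s: "s = {f. f ` K \<subseteq> U}" "compact K" "open U"
      unfolding S_def by blast
    have "compact (f ` K)"
      using s(2) continuous_on_subset[OF f] by (intro compact_continuous_image) auto
    moreover have "\<exists>n. \<forall>y z. agree n x y \<longrightarrow> agree n x z \<longrightarrow> z \<in> U" if "x \<in> f ` K" for x
    proof -
      have "x \<in> U" using Basis(2) s(1) that by auto
      then show ?thesis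
        using s(3) unfolding open_cantor_iff by blast
    qed
    ultimately have "\<exists>n. \<forall>x\<in>f ` K. \<forall>y. agree n x y \<longrightarrow> y \<in> U"
      by (rule compact_cylinder_uniform)
    then obtain n where "\<forall>x\<in>f ` K. \<forall>y. agree n x y \<longrightarrow> y \<in> U" ..
    then have "\<forall>g. (\<forall>x. agree n (g x) (f x)) \<longrightarrow> g \<in> s"
      unfolding s(1) using agree_sym by fast
    then show ?case ..
  qed simp
  then show ?thesis
    using assms(2) T'(2) G_continuous by blast
qed

lemma Homeo_dense_iff:
  assumes "C \<subseteq> G"
  shows "Homeo_topology \<mu> closure_of C = topspace (Homeo_topology \<mu>) \<longleftrightarrow>
    (\<forall>f\<in>G. \<forall>n. \<exists>c\<in>C. \<forall>x. agree n (c x) (f x))" (is "?dense \<longleftrightarrow> ?approx")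
proof
  assume dense: ?dense
  show ?approx
  proof (intro ballI allI)
    fix f n assume f: "f \<in> G"
    then have "f \<in> Homeo_topology \<mu> closure_of C"
      by (simp add: dense topspace_Homeo_topology)
    then have nhd: "\<exists>c\<in>C. c \<in> T" if "f \<in> T" "openin (Homeo_topology \<mu>) T" for T
      using that unfolding in_closure_of by blast
    have "\<exists>c\<in>C. c \<in> {g \<in> G. \<forall>x. agree n (g x) (f x)}"
      by (rule nhd[OF _ openin_Homeo_agree[OF f]]) (simp add: f)
    then show "\<exists>c\<in>C. \<forall>x. agree n (c x) (f x)"
      by blast
  qed
next
  assume approx: ?approx
  have "f \<in> Homeo_topology \<mu> closure_of C" if f: "f \<in> G" for f
    unfolding in_closure_of topspace_Homeo_topology
  proof (intro conjI allI impI f)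
    fix T assume "f \<in> T \<and> openin (Homeo_topology \<mu>) T"
    then obtain n where "\<forall>g\<in>G. (\<forall>x. agree n (g x) (f x)) \<longrightarrow> g \<in> T"
      using openin_Homeo_agree_nhd by blast
    moreover obtain c where "c \<in> C" "\<forall>x. agree n (c x) (f x)"
      using approx f by blast
    ultimately show "\<exists>y. y \<in> C \<and> y \<in> T"
      using assms by blast
  qed
  then show ?dense
    using closure_of_subset_topspace[of "Homeo_topology \<mu>" C] by (auto simp: topspace_Homeo_topology)
qed

lemma conjugacy_class_Homeo:
  "conjugacy_class (Homeo \<mu>) g = {\<phi> \<circ> g \<circ> inv_into UNIV \<phi> | \<phi>. \<phi> \<in> G}"
proof -
  have "x \<otimes>\<^bsub>Homeo \<mu>\<^esub> y = x \<circ> y" for x y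
    by (simp add: Homeo_def)
  then show ?thesis
    unfolding conjugacy_class_def by (intro Collect_cong ex_cong1) (auto simp: inv_Homeo(1))
qed

text \<open>From here on the topology of the group enters only through uniform agreement.\<close>

lemma Rokhlin_Homeo_iff:
  "Rokhlin_property (Homeo \<mu>) (Homeo_topology \<mu>) \<longleftrightarrow>
    (\<exists>h\<in>G. \<forall>f\<in>G. \<forall>n. \<exists>\<phi>\<in>G. \<forall>x. agree n (\<phi> (h (inv_into UNIV \<phi> x))) (f x))"
proof -
  have "Homeo_topology \<mu> closure_of conjugacy_class (Homeo \<mu>) h = topspace (Homeo_topology \<mu>) \<longleftrightarrow>
    (\<forall>f\<in>G. \<forall>n. \<exists>\<phi>\<in>G. \<forall>x. agree n (\<phi> (h (inv_into UNIV \<phi> x))) (f x))" if "h \<in> G" for h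
  proof -
    have "conjugacy_class (Homeo \<mu>) h \<subseteq> G"
      using that by (auto simp: conjugacy_class_Homeo intro!: G_comp inv_Homeo(2))
    moreover have "(\<exists>c\<in>conjugacy_class (Homeo \<mu>) h. P c) \<longleftrightarrow> (\<exists>\<phi>\<in>G. P (\<phi> \<circ> h \<circ> inv_into UNIV \<phi>))" for P
      unfolding conjugacy_class_Homeo by blast
    ultimately show ?thesis
      by (simp add: Homeo_dense_iff)
  qed
  then show ?thesis
    unfolding Rokhlin_property_def by (rule bex_cong[OF refl])
qed

subsection \<open>Periodic elements\<close>

text \<open>The function \<open>t\<close> encodes the clopen tower by its levels, with base
  \<open>A\<close> at level \<open>0\<close>.\<close>

definition periodic :: "nat \<Rightarrow> (cantor \<Rightarrow> cantor) \<Rightarrow> bool" where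
  "periodic N f \<longleftrightarrow> f \<in> G \<and> f ^^ N = id \<and>
     (\<exists>t. loc_const t \<and> (\<forall>x. t x < N) \<and> (\<forall>x. t (f x) = Suc (t x) mod N))"

text \<open>Prescribed towers, numbered by \<open>u\<close> with levels \<open>t\<close>, are
  realised by a periodic element. Homogeneity gives \<open>g k a\<close> from the base of tower
  \<open>k\<close> to its level \<open>a\<close>. The map goes down to the base point by the inverse
  and up again to the next level; as the base point never changes, \<open>N\<close> steps lead back
  to the start.\<close>

lemma periodic_exists:
  fixes t :: "cantor \<Rightarrow> nat" and u :: "cantor \<Rightarrow> nat"
  assumes t: "loc_const t" "\<And>x. t x < N" and u: "loc_const u"
    and eq: "\<And>k a. a < N \<Longrightarrow> prob {x. t x = a \<and> u x = k} = prob {x. t x = 0 \<and> u x = k}"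
  shows "\<exists>f. periodic N f \<and> (\<forall>x. t (f x) = Suc (t x) mod N \<and> u (f x) = u x)"
proof -
  have N: "0 < N"
    using t(2)[of undefined] by simp
  define T where "T k a = {x. t x = a \<and> u x = k}" for k a
  have T: "clopen (T k a)" for k a
    unfolding T_def by (rule clopen_Collect[OF loc_const_comp2[OF t(1) u, of "\<lambda>b l. b = a \<and> l = k"]])
  have "\<exists>g. g \<in> G \<and> (\<forall>x. g x \<in> T k a \<longleftrightarrow> x \<in> T k 0)" if "a < N" for k a
  proof -
    have "prob (T k 0) = prob (T k a)"
      unfolding T_def by (rule eq[OF that, symmetric])
    then obtain g where "g \<in> G" "\<forall>x. g x \<in> T k a \<longleftrightarrow> x \<in> T k 0"
      by (rule exists_transport[OF T T])
    then show ?thesis by blast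
  qed
  note transport = someI_ex[OF this]
  define g where "g k a = (SOME g. g \<in> G \<and> (\<forall>x. g x \<in> T k a \<longleftrightarrow> x \<in> T k 0))" for k a
  have g: "g k a \<in> G" and gT: "g k a x \<in> T k a \<longleftrightarrow> x \<in> T k 0" if "a < N" for k a x
    using transport[OF that, of k] unfolding g_def by blast+
  define base where "base x = inv_into UNIV (g (u x) (t x)) x" for x
  have g_base: "g (u x) (t x) (base x) = x" for x
    unfolding base_def using g t(2) by simp
  have base: "base x \<in> T (u x) 0" for x
    using gT[OF t(2), of "u x" x "base x"] unfolding g_base by (simp add: T_def)
  define F where "F x = g (u x) (Suc (t x) mod N) (base x)" for x
  have FT: "t (F x) = Suc (t x) mod N" "u (F x) = u x" for x
    using gT[of "Suc (t x) mod N" "u x" "base x"] base[of x] N by (auto simp: F_def T_def)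
  have baseF: "base (F x) = base x" for x
    unfolding base_def[of "F x"] FT using g N by (simp add: F_def)
  have iter: "t ((F ^^ j) x) = (t x + j) mod N \<and> u ((F ^^ j) x) = u x \<and> base ((F ^^ j) x) = base x" for j x
    by (induction j) (auto simp: FT baseF t(2) mod_Suc_eq)
  have FN: "F ^^ N = id"
  proof
    fix x
    have "(F ^^ N) x = g (u ((F ^^ N) x)) (t ((F ^^ N) x)) (base ((F ^^ N) x))"
      by (simp only: g_base)
    also have "\<dots> = x"
      using iter[of N x] by (simp add: t(2) g_base)
    finally show "(F ^^ N) x = id x" by simp
  qed
  obtain M where M: "N = Suc M"
    using N gr0_conv_Suc by blast
  have "bij F"
  proof (rule o_bij)
    show "(F ^^ M) \<circ> F = id"
      using FN unfolding M funpow_Suc_right .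
    show "F \<circ> (F ^^ M) = id"
      using FN unfolding M funpow.simps .
  qed
  \<comment> \<open>Gluing asks for a group element at every label; \<open>id\<close> fills in for
    levels \<open>a\<close> outside the tower.\<close>
  then have "F \<in> G"
    using glue_in_G[of "\<lambda>x. (u x, t x)" "\<lambda>(k, a). if a < N then g k (Suc a mod N) \<circ> inv_into UNIV (g k a) else id"]
      loc_const_comp2[OF u t(1), of Pair] g N t(2)
    by (simp add: F_def[abs_def] base_def G_comp inv_Homeo(2))
  then show ?thesis
    using FT FN t unfolding periodic_def by blast
qed

text \<open>The preimage of \<open>C\<close> at level \<open>b + 1\<close> is \<open>C\<close> at
  level \<open>b\<close>, so all \<open>N\<close> levels of \<open>C\<close> have the same measure.
  This applies to periodic elements and also, for the converse direction, to an element that merely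
  permutes the levels.\<close>

lemma periodic_level_prob:
  assumes "f \<in> G" "loc_const t" "\<And>x. t x < N" "\<And>x. t (f x) = Suc (t x) mod N"
    and C: "clopen C" "\<And>x. f x \<in> C \<longleftrightarrow> x \<in> C" and "a < N"
  shows "prob (C \<inter> t -` {a}) = prob C / N"
proof -
  have cl: "clopen (C \<inter> t -` {b})" for b
    by (intro clopen_Int C clopen_vimage_loc_const assms(2))
  have level: "prob (C \<inter> t -` {b}) = prob (C \<inter> t -` {0})" if "b < N" for b
    using that
  proof (induction b)
    case (Suc b)
    have "Suc (t x) mod N = Suc b \<longleftrightarrow> t x = b" for x
      using Suc.prems assms(3)[of x] by (cases "Suc (t x) = N") auto
    then have "f -` (C \<inter> t -` {Suc b}) = C \<inter> t -` {b}"
      by (auto simp: assms(4) C(2))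
    then show ?case
      using G_prob[OF assms(1) cl[of "Suc b"]] Suc by simp
  qed simp
  have "prob C = (\<Sum>b\<in>{..<N}. prob (C \<inter> t -` {b}))"
    by (rule prob_decompose) (use assms C in auto)
  also have "\<dots> = (\<Sum>b\<in>{..<N}. prob (C \<inter> t -` {0}))"
    by (intro sum.cong level) auto
  finally show ?thesis
    using level[OF \<open>a < N\<close>] \<open>a < N\<close> by simp
qed

text \<open>Both bases have measure \<open>1 / N\<close>, so some \<open>g\<close> in
  \<open>G\<close> exchanges them; \<open>\<phi>\<close> extends \<open>g\<close> along the
  towers.\<close>

lemma periodic_conjugate:
  assumes "periodic N f" "periodic N f'"
  obtains \<phi> where "\<phi> \<in> G" "\<forall>x. \<phi> (f x) = f' (\<phi> x)"
proof -
  obtain t where f: "f \<in> G" "f ^^ N = id" and t: "loc_const t" "\<And>x. t x < N"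
    "\<And>x. t (f x) = Suc (t x) mod N"
    using assms(1) unfolding periodic_def by auto
  obtain t' where f': "f' \<in> G" "f' ^^ N = id" and t': "loc_const t'" "\<And>x. t' x < N"
    "\<And>x. t' (f' x) = Suc (t' x) mod N"
    using assms(2) unfolding periodic_def by auto
  have N: "0 < N"
    using t(2)[of undefined] by simp
  have "prob (UNIV \<inter> t -` {0}) = prob UNIV / N"
    by (rule periodic_level_prob[OF f(1) t]) (use N in auto)
  moreover have "prob (UNIV \<inter> t' -` {0}) = prob UNIV / N"
    by (rule periodic_level_prob[OF f'(1) t']) (use N in auto)
  ultimately have "prob (t -` {0}) = prob (t' -` {0})"
    by simp
  then obtain g where g: "g \<in> G" "\<forall>x. g x \<in> t' -` {0} \<longleftrightarrow> x \<in> t -` {0}"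
    using exists_transport[OF clopen_vimage_loc_const[OF t(1)] clopen_vimage_loc_const[OF t'(1)]] by blast
  define g' where "g' = inv_into UNIV g"
  have g'0: "t (g' y) = 0" if "t' y = 0" for y
    using g(2)[rule_format, of "g' y"] that by (simp add: g'_def g(1))
  define \<phi> where "\<phi> x = (f' ^^ t x) (g ((f ^^ (N - t x)) x))" for x
  define \<psi> where "\<psi> y = (f ^^ t' y) (g' ((f' ^^ (N - t' y)) y))" for y
  have "\<psi> (\<phi> x) = x" for x
    by (rule tower_conjugator_inverse[where t = t and t' = t' and f = f and f' = f'
          and g = g and g' = g' and \<phi> = \<phi> and \<psi> = \<psi>, OF t(3,2) f(2) t'(3,2) f'(2)])
      (use g in \<open>simp_all add: g'_def \<phi>_def \<psi>_def\<close>)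
  moreover have "\<phi> (\<psi> y) = y" for y
    by (rule tower_conjugator_inverse[where t = t' and t' = t and f = f' and f' = f
          and g = g' and g' = g and \<phi> = \<psi> and \<psi> = \<phi>, OF t'(3,2) f'(2) t(3,2) f(2)])
      (use g(1) g'0 in \<open>simp_all add: g'_def \<phi>_def \<psi>_def\<close>)
  ultimately have "bij \<phi>"
    by (intro o_bij[of \<psi>]) auto
  then have "\<phi> \<in> G"
    using glue_in_G[of t "\<lambda>a. (f' ^^ a) \<circ> g \<circ> (f ^^ (N - a))"] t(1) f(1) f'(1) g(1)
    by (simp add: \<phi>_def[abs_def] G_comp G_funpow)
  moreover have "\<phi> (f x) = f' (\<phi> x)" for x
  \<comment> \<open>At the top level the exponents do not shift by one but wrap around; there
    \<open>f ^^ N\<close> and \<open>f' ^^ N\<close> being \<open>id\<close> closes the gap.\<close>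
  proof (cases "Suc (t x) = N")
    case True
    have "f' (\<phi> x) = (f' ^^ N) (g (f x))"
      unfolding \<phi>_def True[symmetric] by simp
    moreover have "\<phi> (f x) = g ((f ^^ N) (f x))"
      unfolding \<phi>_def t(3) True by simp
    ultimately show ?thesis
      by (simp add: f(2) f'(2))
  next
    case False
    then have lt: "Suc (t x) < N"
      using t(2)[of x] by simp
    then have "N - t x = Suc (N - Suc (t x))"
      by simp
    then have "(f ^^ (N - t x)) x = (f ^^ (N - Suc (t x))) (f x)"
      by (simp only: funpow_Suc_right comp_apply)
    then show ?thesis
      unfolding \<phi>_def t(3) using lt by simp
  qed
  ultimately show ?thesis
    by (intro that) auto
qed

subsection \<open>Density of the periodic elements\<close>

text \<open>
  Here \<open>u\<close> numbers the towers over \<open>Y\<close> and \<open>t\<close> is the level in a tower. With \<open>r\<close> a partition of the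
  space and \<open>s = r \<circ> f\<close>, the last condition says that climbing the towers approximates \<open>f\<close> up to \<open>r\<close>.
\<close>

definition towers ::
    "cantor set \<Rightarrow> (cantor \<Rightarrow> 'a) \<Rightarrow> (cantor \<Rightarrow> 'a) \<Rightarrow> nat \<Rightarrow> (cantor \<Rightarrow> nat) \<Rightarrow> (cantor \<Rightarrow> nat) \<Rightarrow> bool" where
  "towers Y r s N t u \<longleftrightarrow> loc_const t \<and> loc_const u \<and> (\<forall>x\<in>Y. t x < N) \<and>
     (\<forall>k. \<forall>a<N. prob {x\<in>Y. t x = a \<and> u x = k} = prob {x\<in>Y. t x = 0 \<and> u x = k}) \<and>
     (\<forall>x\<in>Y. \<forall>y\<in>Y. u x = u y \<longrightarrow> t y = Suc (t x) mod N \<longrightarrow> r y = s x)"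

text \<open>Divisibility makes the \<open>K\<close>-th part of the measure of \<open>B\<close> a
  clopen value. Disjoint sets of that size leave a null clopen remainder, empty by fullness.\<close>

lemma split_evenly:
  fixes K :: nat
  assumes div: "\<forall>v\<in>clopen_values \<mu>. \<forall>K>0. v / real K \<in> clopen_values \<mu>"
    and B: "clopen B" and K: "0 < K"
  shows "\<exists>C. (\<forall>b<K. clopen (C b) \<and> C b \<subseteq> B \<and> prob (C b) = prob B / K) \<and>
    disjoint_family_on C {..<K} \<and> (\<forall>x\<in>B. \<exists>b<K. x \<in> C b)"
proof -
  have "(\<Sum>b\<in>{..<K}. prob B / K) \<le> prob B"
    using K by simp
  then obtain C where C: "\<forall>b\<in>{..<K}. clopen (C b) \<and> C b \<subseteq> B \<and> prob (C b) = prob B / K"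
    and disj: "disjoint_family_on C {..<K}"
    using disjoint_clopens[OF B finite_lessThan, of K "\<lambda>_. prob B / K"] div[rule_format, OF prob_in_values[OF B] K] by auto
  have clU: "clopen (\<Union>b\<in>{..<K}. C b)"
    using C by (intro clopen_UN) auto
  have "prob (\<Union>b\<in>{..<K}. C b) = prob B"
    using C disj K by (subst prob_UN_clopen) auto
  moreover have "(\<Union>b\<in>{..<K}. C b) \<subseteq> B"
    using C by auto
  ultimately have "prob (B - (\<Union>b\<in>{..<K}. C b)) = 0"
    by (subst prob_Diff_clopen) (auto intro: clU B)
  then have "B - (\<Union>b\<in>{..<K}. C b) = {}"
    by (intro clopen_null clopen_Diff clU B)
  then show ?thesis
    using C disj by (intro exI[of _ C]) auto
qed

text \<open>The sets \<open>B a\<close> are the edges of a cycle of length \<open>l\<close>, each of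
  weight \<open>w\<close>. Each is split into \<open>N div l\<close> equal parts, and the
  \<open>N\<close> parts are stacked into one new tower which runs round the cycle
  \<open>N div l\<close> times. Old tower numbers move up by one to free the number
  \<open>0\<close>.\<close>

lemma towers_add_cycle:
  assumes div: "\<forall>v\<in>clopen_values \<mu>. \<forall>K>0. v / real K \<in> clopen_values \<mu>"
    and l: "0 < l" "(\<sigma> ^^ l) i = i" "l dvd N" and N: "0 < N"
    and B: "\<And>a. a < l \<Longrightarrow> clopen (B a)" "\<And>a. a < l \<Longrightarrow> prob (B a) = w"
    and rs: "\<And>a x. a < l \<Longrightarrow> x \<in> B a \<Longrightarrow> r x = (\<sigma> ^^ a) i \<and> s x = (\<sigma> ^^ Suc a) i"
    and disj: "disjoint_family_on B {..<l}"
    and Y: "clopen Y" "Y \<inter> (\<Union>a<l. B a) = {}"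
    and tu: "towers Y r s N t u"
  shows "\<exists>t u. towers (Y \<union> (\<Union>a<l. B a)) r s N t u"
proof -
  define K where "K = N div l"
  have NK: "N = K * l" and K: "0 < K"
    using l N by (auto simp: K_def elim!: dvdE)
  have "\<forall>a. \<exists>C. a < l \<longrightarrow> (\<forall>b<K. clopen (C b) \<and> C b \<subseteq> B a \<and> prob (C b) = w / K) \<and>
      disjoint_family_on C {..<K} \<and> (\<forall>x\<in>B a. \<exists>b<K. x \<in> C b)"
  proof (intro allI)
    fix a
    show "\<exists>C. a < l \<longrightarrow> (\<forall>b<K. clopen (C b) \<and> C b \<subseteq> B a \<and> prob (C b) = w / K) \<and>
      disjoint_family_on C {..<K} \<and> (\<forall>x\<in>B a. \<exists>b<K. x \<in> C b)"
    proof (cases "a < l")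
      case True
      show ?thesis
        using split_evenly[OF div B(1)[OF True] K] unfolding B(2)[OF True] by blast
    qed simp
  qed
  then obtain C where C': "\<forall>a. a < l \<longrightarrow> (\<forall>b<K. clopen (C a b) \<and> C a b \<subseteq> B a \<and> prob (C a b) = w / K) \<and>
      disjoint_family_on (C a) {..<K} \<and> (\<forall>x\<in>B a. \<exists>b<K. x \<in> C a b)"
    by (rule choice[THEN exE])
  then have C: "clopen (C a b)" "C a b \<subseteq> B a" "prob (C a b) = w / K" if "a < l" "b < K" for a b
    using that by blast+
  have C_disj: "disjoint_family_on (C a) {..<K}" and C_cover: "\<forall>x\<in>B a. \<exists>b<K. x \<in> C a b" if "a < l" for a
    using that C' by blast+
  \<comment> \<open>Level \<open>n\<close> is at position \<open>n mod l\<close> of the cycle, in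
    round \<open>n div l\<close>.\<close>
  define A where "A n = C (n mod l) (n div l)" for n
  have idx: "n mod l < l" "n div l < K" if "n < N" for n
    using that l(1) by (simp_all add: NK less_mult_imp_div_less)
  have A: "clopen (A n)" "A n \<subseteq> B (n mod l)" "prob (A n) = w / K" if "n < N" for n
    using C idx that by (simp_all add: A_def)
  have A_disj: "disjoint_family_on A {..<N}"
    unfolding disjoint_family_on_def
  proof (intro ballI impI)
    fix m n assume mn: "m \<in> {..<N}" "n \<in> {..<N}" "m \<noteq> n"
    show "A m \<inter> A n = {}"
    proof (cases "m mod l = n mod l")
      case True
      then have "m div l \<noteq> n div l"
        using mn(3) by (metis div_mult_mod_eq)
      then show ?thesis
        using C_disj[of "n mod l"] idx mn(1,2) True unfolding A_def disjoint_family_on_def by auto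
    next
      case False
      then have "B (m mod l) \<inter> B (n mod l) = {}"
        using disj idx mn(1,2) unfolding disjoint_family_on_def by auto
      then show ?thesis
        using A(2)[of m] A(2)[of n] mn(1,2) by auto
    qed
  qed
  obtain t0 where t0: "loc_const t0" and tA: "\<forall>n\<in>{..<N}. \<forall>x\<in>A n. t0 x = n"
    using loc_const_label[of "{..<N}" A] A(1) A_disj by auto
  have A_cover: "\<exists>n<N. x \<in> A n" if x: "x \<in> B a" and a: "a < l" for x a
  proof -
    obtain b where b: "b < K" "x \<in> C a b"
      using C_cover[OF a] x by blast
    have "b * l + a < N"
    proof -
      have "b * l + a < Suc b * l"
        using a by simp
      also have "\<dots> \<le> N"
        unfolding NK using b(1) by (intro mult_le_mono1) simp
      finally show ?thesis .
    qed
    moreover have "x \<in> A (b * l + a)"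
      using b(2) a by (simp add: A_def)
    ultimately show ?thesis by blast
  qed
  define Z where "Z = (\<Union>a<l. B a)"
  have YZ: "x \<notin> Z" if "x \<in> Y" for x
    using that Y(2) by (auto simp: Z_def)
  have Z_A: "x \<in> A (t0 x) \<and> t0 x < N" if "x \<in> Z" for x
  proof -
    obtain n where "n < N" "x \<in> A n"
      using A_cover \<open>x \<in> Z\<close> unfolding Z_def by blast
    then show ?thesis using tA by auto
  qed
  have A_Z: "A n \<subseteq> Z" if "n < N" for n
    using A(2)[OF that] idx(1)[OF that] unfolding Z_def by blast
  define t1 where "t1 x = (if x \<in> Y then t x else t0 x)" for x
  define u1 where "u1 x = (if x \<in> Y then Suc (u x) else 0)" for x
  have lcY: "loc_const (\<lambda>x. x \<in> Y)" and lct: "loc_const t" "loc_const u"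
    using Y(1) tu by (simp_all add: clopen_iff_loc_const towers_def)
  have "loc_const t1"
  proof -
    have "loc_const (\<lambda>x. if fst (x \<in> Y, t x) then snd (x \<in> Y, t x) else t0 x)"
      using loc_const_comp2[OF loc_const_comp2[OF lcY lct(1), of Pair] t0,
          of "\<lambda>p c. if fst p then snd p else c"] by simp
    then show ?thesis by (simp add: t1_def[abs_def] cong: if_cong)
  qed
  moreover have "loc_const u1"
    using loc_const_comp2[OF lcY lct(2), of "\<lambda>b k. if b then Suc k else 0"] by (simp add: u1_def[abs_def])
  moreover have "t1 x < N" if "x \<in> Y \<union> Z" for x
    using that tu Z_A by (auto simp: t1_def towers_def)
  moreover have "prob {x\<in>Y \<union> Z. t1 x = a \<and> u1 x = k} = prob {x\<in>Y \<union> Z. t1 x = 0 \<and> u1 x = k}"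
    if "a < N" for a k
  proof (cases k)
    case 0
    have "{x\<in>Y \<union> Z. t1 x = a \<and> u1 x = 0} = A a" if "a < N" for a
    proof (intro antisym subsetI)
      fix x assume "x \<in> {x\<in>Y \<union> Z. t1 x = a \<and> u1 x = 0}"
      then show "x \<in> A a"
        using Z_A[of x] by (auto simp: t1_def u1_def split: if_splits)
    next
      fix x assume x: "x \<in> A a"
      then have "x \<in> Z" "t0 x = a"
        using A_Z[OF that] tA that by auto
      then show "x \<in> {x\<in>Y \<union> Z. t1 x = a \<and> u1 x = 0}"
        using YZ by (auto simp: t1_def u1_def)
    qed
    then show ?thesis
      using 0 that N A(3) by simp
  next
    case (Suc k')
    have "{x\<in>Y \<union> Z. t1 x = a \<and> u1 x = k} = {x\<in>Y. t x = a \<and> u x = k'}" for a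
      using Suc by (auto simp: t1_def u1_def)
    moreover have "prob {x\<in>Y. t x = a \<and> u x = k'} = prob {x\<in>Y. t x = 0 \<and> u x = k'}"
      using tu that unfolding towers_def by blast
    ultimately show ?thesis
      by simp
  qed
  moreover have "r y = s x" if xy: "x \<in> Y \<union> Z" "y \<in> Y \<union> Z" "u1 x = u1 y" "t1 y = Suc (t1 x) mod N" for x y
  proof (cases "x \<in> Y")
    case True
    then have "y \<in> Y" using xy(3) by (simp add: u1_def split: if_splits)
    then show ?thesis
      using True xy tu by (simp add: towers_def t1_def u1_def)
  next
    case False
    then have "y \<notin> Y" using xy(3) by (simp add: u1_def split: if_splits)
    with False have Z: "x \<in> Z" "y \<in> Z" and t0': "t0 y = Suc (t0 x) mod N"
      using xy by (auto simp: t1_def)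
    have "x \<in> B (t0 x mod l)" "y \<in> B (t0 y mod l)"
      using Z_A[OF Z(1)] Z_A[OF Z(2)] A(2) by blast+
    then have "s x = (\<sigma> ^^ Suc (t0 x mod l)) i" "r y = (\<sigma> ^^ (t0 y mod l)) i"
      using rs l(1) by simp_all
    \<comment> \<open>The step from level \<open>N - 1\<close> to level \<open>0\<close> also
      advances one place along the cycle, because \<open>l dvd N\<close>.\<close>
    moreover have "t0 y mod l = Suc (t0 x mod l) mod l"
      unfolding t0' using l(3) by (simp add: mod_mod_cancel mod_Suc_eq)
    ultimately show ?thesis
      using funpow_mod_eq[OF l(2), of "Suc (t0 x mod l)"] by simp
  qed
  ultimately have "towers (Y \<union> Z) r s N t1 u1"
    unfolding towers_def by blast
  then show ?thesis
    unfolding Z_def by blast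
qed

text \<open>Decomposition of a circulation into cycles. Vertices are the labels, edges the pairs
  \<open>(r x, s x)\<close>, weights the measures, and the hypothesis on \<open>Y\<close> equates
  outflow and inflow. Subtracting the least weight along a cycle preserves this and deletes an edge;
  induction on the number of edges. \<open>L\<close> is the product of the cycle lengths.\<close>

lemma towers_exist:
  assumes div: "\<forall>v\<in>clopen_values \<mu>. \<forall>K>0. v / real K \<in> clopen_values \<mu>"
    and r: "loc_const r" and s: "loc_const s"
    and Y: "clopen Y" "\<And>j. prob (Y \<inter> r -` {j}) = prob (Y \<inter> s -` {j})"
  shows "\<exists>L>0. \<forall>N>0. L dvd N \<longrightarrow> (\<exists>t u. towers Y r s N t u)"
  using Y
proof (induction "card ((\<lambda>x. (r x, s x)) ` Y)" arbitrary: Y rule: less_induct)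
  case less
  have lc: "loc_const (\<lambda>x. (r x, s x))"
    by (rule loc_const_comp2[OF r s])
  have fin: "finite ((\<lambda>x. (r x, s x)) ` S)" for S
    using finite_range_loc_const[OF lc] by (rule finite_subset[rotated]) auto
  have bal: "prob (Y \<inter> r -` {j}) = prob (Y \<inter> s -` {j})" for j
    by (rule less.prems(2))
  have clr: "clopen (S \<inter> r -` {j})" and cls: "clopen (S \<inter> s -` {j})" if "clopen S" for S j
    using that by (intro clopen_Int clopen_vimage_loc_const r s; simp)+
  show ?case
  proof (cases "Y = {}")
    case True
    then show ?thesis
      by (intro exI[of _ 1]) (auto simp: towers_def intro!: exI[of _ "\<lambda>_. 0"])
  next
    case False
    \<comment> \<open>A vertex with inflow has outflow, so a path along edges can always be
      continued.\<close>
    have "s ` Y \<subseteq> r ` Y"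
    proof
      fix j assume "j \<in> s ` Y"
      then have "Y \<inter> s -` {j} \<noteq> {}" by auto
      then have "prob (Y \<inter> r -` {j}) \<noteq> 0"
        using clopen_null[OF cls[OF less.prems(1)], of j] bal by auto
      then have "Y \<inter> r -` {j} \<noteq> {}" by force
      then show "j \<in> r ` Y" by auto
    qed
    then have "\<forall>j\<in>r ` Y. \<exists>j'\<in>r ` Y. \<exists>x\<in>Y. r x = j \<and> s x = j'"
      by blast
    then obtain \<sigma> where \<sigma>: "\<And>j. j \<in> r ` Y \<Longrightarrow> \<sigma> j \<in> r ` Y" "\<And>j. j \<in> r ` Y \<Longrightarrow> \<exists>x\<in>Y. r x = j \<and> s x = \<sigma> j"
      by metis
    have "finite (r ` Y)"
      using finite_range_loc_const[OF r] by (rule finite_subset[rotated]) auto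
    moreover obtain i0 where "i0 \<in> r ` Y"
      using False by blast
    ultimately obtain i l where i: "i \<in> r ` Y" and l: "0 < l" "(\<sigma> ^^ l) i = i"
      and inj: "inj_on (\<lambda>a. (\<sigma> ^^ a) i) {..<l}"
      using \<sigma>(1) by (rule finite_self_map_cycle)
    have orbit: "(\<sigma> ^^ a) i \<in> r ` Y" for a
      by (induction a) (simp_all add: i \<sigma>(1))
    define E where "E a = (Y \<inter> r -` {(\<sigma> ^^ a) i}) \<inter> s -` {(\<sigma> ^^ Suc a) i}" for a
    have clE: "clopen (E a)" for a
      unfolding E_def by (intro cls clr less.prems(1))
    \<comment> \<open>The bottleneck weight, attained at \<open>a0\<close>: removing it from every
      edge of the cycle exhausts \<open>E a0\<close>.\<close>
    define w where "w = Min ((\<lambda>a. prob (E a)) ` {..<l})"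
    have "w \<in> (\<lambda>a. prob (E a)) ` {..<l}"
      unfolding w_def using l(1) by (intro Min_in) auto
    then obtain a0 where a0: "a0 < l" "w = prob (E a0)"
      by auto
    have w_le: "w \<le> prob (E a)" if "a < l" for a
      unfolding w_def using that by (intro Min_le) auto
    have w_val: "w \<in> clopen_values \<mu>"
      unfolding a0(2) by (intro prob_in_values clE)
    have "\<forall>a. \<exists>W. a < l \<longrightarrow> clopen W \<and> W \<subseteq> E a \<and> prob W = w"
      using clopen_subset_prob[OF clE w_val w_le] by blast
    then obtain B where B: "\<forall>a. a < l \<longrightarrow> clopen (B a) \<and> B a \<subseteq> E a \<and> prob (B a) = w"
      by (rule choice[THEN exE])
    have rs: "r x = (\<sigma> ^^ a) i \<and> s x = (\<sigma> ^^ Suc a) i \<and> x \<in> Y" if "a < l" "x \<in> B a" for a x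
      using B that unfolding E_def by blast
    have disj: "disjoint_family_on B {..<l}"
      unfolding disjoint_family_on_def
    proof (intro ballI impI)
      fix a b assume ab: "a \<in> {..<l}" "b \<in> {..<l}" "a \<noteq> b"
      then have "(\<sigma> ^^ a) i \<noteq> (\<sigma> ^^ b) i"
        using inj by (auto dest: inj_onD)
      then show "B a \<inter> B b = {}"
        using rs ab(1,2) by (metis disjoint_iff lessThan_iff)
    qed
    define Z where "Z = (\<Union>a<l. B a)"
    have clZ: "clopen Z"
      unfolding Z_def using B by (intro clopen_UN) auto
    have Z_Y: "Z \<subseteq> Y"
      unfolding Z_def using rs by blast
    have clY': "clopen (Y - Z)"
      by (intro clopen_Diff less.prems clZ)
    have prob_Z: "prob (Z \<inter> p -` {j}) = (\<Sum>a<l. if (\<sigma> ^^ f a) i = j then w else 0)"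
      if p: "loc_const p" and pf: "\<And>a x. a < l \<Longrightarrow> x \<in> B a \<Longrightarrow> p x = (\<sigma> ^^ f a) i" for p f j
    proof -
      have "Z \<inter> p -` {j} = (\<Union>a<l. if (\<sigma> ^^ f a) i = j then B a else {})"
        unfolding Z_def using pf by (auto split: if_splits)
      also have "prob \<dots> = (\<Sum>a<l. prob (if (\<sigma> ^^ f a) i = j then B a else {}))"
        using B disj by (intro prob_UN_clopen) (auto simp: disjoint_family_on_def)
      also have "\<dots> = (\<Sum>a<l. if (\<sigma> ^^ f a) i = j then w else 0)"
        using B by (intro sum.cong) auto
      finally show ?thesis .
    qed
    have "prob ((Y - Z) \<inter> r -` {j}) = prob ((Y - Z) \<inter> s -` {j})" for j
    proof -
      define c where "c a = (if (\<sigma> ^^ a) i = j then w else 0)" for a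
      \<comment> \<open>Outflow and inflow removed at \<open>j\<close> are sums over the same cycle
        shifted by one; they agree since \<open>c l = c 0\<close>.\<close>
      have "(\<Sum>a<l. c (Suc a)) = (\<Sum>a<l. c a)"
        using sum.lessThan_Suc_shift[of c l] sum.lessThan_Suc[of c l] l(2) by (simp add: c_def)
      then have Z: "prob (Z \<inter> r -` {j}) = prob (Z \<inter> s -` {j})"
        using prob_Z[OF r, of "\<lambda>a. a" j] prob_Z[OF s, of Suc j] rs unfolding c_def by simp
      have diff: "prob ((Y - Z) \<inter> p -` {j}) = prob (Y \<inter> p -` {j}) - prob (Z \<inter> p -` {j})"
        if p: "loc_const p" for p
      proof -
        have "(Y - Z) \<inter> p -` {j} = (Y \<inter> p -` {j}) - (Z \<inter> p -` {j})"
          by auto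
        then show ?thesis
          using Z_Y by (simp, intro prob_Diff_clopen clopen_Int clopen_vimage_loc_const p less.prems(1) clZ) auto
      qed
      show ?thesis
        unfolding diff[OF r] diff[OF s] Z bal ..
    qed
    note bal' = this
    have "card ((\<lambda>x. (r x, s x)) ` (Y - Z)) < card ((\<lambda>x. (r x, s x)) ` Y)"
    proof (rule psubset_card_mono[OF fin], rule psubsetI)
      show "(\<lambda>x. (r x, s x)) ` (Y - Z) \<subseteq> (\<lambda>x. (r x, s x)) ` Y"
        by auto
      have "E a0 - B a0 = {}"
      proof (rule clopen_null)
        show "clopen (E a0 - B a0)"
          using B a0(1) by (intro clopen_Diff clE) auto
        have "prob (E a0 - B a0) = prob (E a0) - prob (B a0)"
          using B a0(1) by (intro prob_Diff_clopen clE) auto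
        then show "prob (E a0 - B a0) = 0"
          using B a0 by simp
      qed
      then have "E a0 \<subseteq> Z"
        unfolding Z_def using a0(1) by blast
      have "((\<sigma> ^^ a0) i, (\<sigma> ^^ Suc a0) i) \<notin> (\<lambda>x. (r x, s x)) ` (Y - Z)"
      proof
        assume "((\<sigma> ^^ a0) i, (\<sigma> ^^ Suc a0) i) \<in> (\<lambda>x. (r x, s x)) ` (Y - Z)"
        then obtain x where "x \<in> Y - Z" "r x = (\<sigma> ^^ a0) i" "s x = (\<sigma> ^^ Suc a0) i"
          by (elim imageE) (simp only: prod.inject)
        with \<open>E a0 \<subseteq> Z\<close> show False
          by (auto simp: E_def)
      qed
      moreover have "((\<sigma> ^^ a0) i, (\<sigma> ^^ Suc a0) i) \<in> (\<lambda>x. (r x, s x)) ` Y"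
        using \<sigma>(2)[OF orbit[of a0]] by (force simp: image_iff)
      ultimately show "(\<lambda>x. (r x, s x)) ` (Y - Z) \<noteq> (\<lambda>x. (r x, s x)) ` Y"
        by blast
    qed
    then have "\<exists>L>0. \<forall>N>0. L dvd N \<longrightarrow> (\<exists>t u. towers (Y - Z) r s N t u)"
      using clY' bal' by (rule less.hyps)
    then obtain L where L: "0 < L" "\<forall>N>0. L dvd N \<longrightarrow> (\<exists>t u. towers (Y - Z) r s N t u)"
      by blast
    have "\<exists>t u. towers Y r s N t u" if N: "0 < N" "L * l dvd N" for N
    proof -
      have dvd: "L dvd N" "l dvd N"
        using N(2) by (auto dest: dvd_mult_left dvd_mult_right)
      obtain t u where "towers (Y - Z) r s N t u"
        using L(2) N(1) dvd(1) by blast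
      then have "\<exists>t u. towers ((Y - Z) \<union> (\<Union>a<l. B a)) r s N t u"
        by (intro towers_add_cycle[OF div l dvd(2) N(1), where B = B and w = w])
          (use B rs disj clY' in \<open>auto simp: Z_def\<close>)
      moreover have "(Y - Z) \<union> (\<Union>a<l. B a) = Y"
        using Z_Y by (auto simp: Z_def)
      ultimately show ?thesis
        by simp
    qed
    then show ?thesis
      using L(1) l(1) by (intro exI[of _ "L * l"]) simp
  qed
qed

text \<open>Apply the tower construction to the prefix label \<open>r\<close> and its composite with
  \<open>f\<close>; they are balanced because \<open>f\<close> preserves the measure. Climbing such
  towers agrees with \<open>f\<close> to depth \<open>n\<close>.\<close>

lemma periodic_dense:
  assumes div: "\<forall>v\<in>clopen_values \<mu>. \<forall>K>0. v / real K \<in> clopen_values \<mu>"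
    and f: "f \<in> G"
  shows "\<exists>L>0. \<forall>N>0. L dvd N \<longrightarrow> (\<exists>f'. periodic N f' \<and> (\<forall>x. agree n (f' x) (f x)))"
proof -
  define r where "r x = map x [0..<n]" for x :: cantor
  have r: "loc_const r"
    unfolding r_def by (rule loc_const_prefix)
  have s: "loc_const (\<lambda>x. r (f x))"
    by (rule loc_const_G[OF f r])
  have bal: "prob (UNIV \<inter> r -` {j}) = prob (UNIV \<inter> (\<lambda>x. r (f x)) -` {j})" for j
    using G_prob[OF f clopen_vimage_loc_const[OF r], of "{j}"] by (simp add: vimage_def)
  obtain L where L: "0 < L"
    "\<forall>N>0. L dvd N \<longrightarrow> (\<exists>t u. towers UNIV r (\<lambda>x. r (f x)) N t u)"
    using towers_exist[OF div r s clopen_UNIV bal] by blast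
  have "\<exists>f'. periodic N f' \<and> (\<forall>x. agree n (f' x) (f x))" if N: "0 < N" "L dvd N" for N
  proof -
    obtain t u where tu: "towers UNIV r (\<lambda>x. r (f x)) N t u"
      using L N by blast
    then have t: "loc_const t" "\<And>x. t x < N" and u: "loc_const u"
      by (simp_all only: towers_def UNIV_I simp_thms ball_UNIV)
    have eq: "prob {x. t x = a \<and> u x = k} = prob {x. t x = 0 \<and> u x = k}" if "a < N" for k a
    proof -
      have "prob {x\<in>UNIV. t x = a \<and> u x = k} = prob {x\<in>UNIV. t x = 0 \<and> u x = k}"
        using tu that unfolding towers_def by blast
      then show ?thesis by simp
    qed
    have rs: "r y = r (f x)" if "u x = u y" "t y = Suc (t x) mod N" for x y
      using tu that unfolding towers_def by blast
    obtain f' where f': "periodic N f'" "\<forall>x. t (f' x) = Suc (t x) mod N \<and> u (f' x) = u x"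
      using periodic_exists[OF t u eq] by blast
    have "agree n (f' x) (f x)" for x
      using rs[of x "f' x"] f'(2) by (simp add: agree_iff_prefix r_def)
    then show ?thesis
      using f'(1) by blast
  qed
  then show ?thesis
    using L(1) by blast
qed

subsection \<open>The Rokhlin property\<close>

text \<open>Take \<open>n\<close> as a modulus of continuity for the inverse of \<open>f\<close> and
  apply it to \<open>y\<close> and the image under \<open>f\<close> of the point that
  \<open>g\<close> sends to \<open>y\<close>.\<close>

lemma inv_agree:
  assumes "f \<in> G"
  obtains n where "\<forall>g\<in>G. (\<forall>x. agree n (g x) (f x)) \<longrightarrow> (\<forall>y. agree k (inv_into UNIV g y) (inv_into UNIV f y))"
proof -
  obtain n where n: "\<And>x y. agree n x y \<Longrightarrow> agree k (inv_into UNIV f x) (inv_into UNIV f y)"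
    using continuous_modulus[OF G_continuous[OF inv_Homeo(2)[OF assms]]] by blast
  have "agree k (inv_into UNIV g y) (inv_into UNIV f y)"
    if g: "g \<in> G" and a: "\<forall>x. agree n (g x) (f x)" for g y
  proof -
    have "agree n (f (inv_into UNIV g y)) y"
      using agree_sym[OF a[rule_format, of "inv_into UNIV g y"]] g by simp
    from n[OF this] show ?thesis
      using assms by simp
  qed
  then show ?thesis
    by (intro that[of n]) blast
qed

text \<open>Uniform limits of homeomorphisms may fail to be injective; \<open>inv_near\<close> makes
  the inverses converge as well, and the two limits are mutually inverse.\<close>

lemma limit_in_G:
  fixes F :: "nat \<Rightarrow> cantor \<Rightarrow> cantor" and n :: "nat \<Rightarrow> nat"
  assumes F: "\<And>k. F k \<in> G" and n: "\<And>k. k \<le> n k" "\<And>k. n k \<le> n (Suc k)"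
    and step: "\<And>k x. agree (n k) (F (Suc k) x) (F k x)"
    and inv_near: "\<And>k g. g \<in> G \<Longrightarrow> \<forall>x. agree (n k) (g x) (F k x) \<Longrightarrow>
      \<forall>y. agree k (inv_into UNIV g y) (inv_into UNIV (F k) y)"
  obtains h where "h \<in> G" "\<forall>k x. agree (n k) (h x) (F k x)"
proof -
  have near: "agree (n k) (F l x) (F k x)" if "k \<le> l" for k l x
    using that
  proof (induction rule: dec_induct)
    case (step l)
    have "n k \<le> n l"
      using n(2) step.hyps(1) by (rule lift_Suc_mono_le)
    then show ?case
      using agree_mono[OF assms(4)[of l x]] step.IH agree_trans by blast
  qed simp
  have near': "agree k (inv_into UNIV (F l) y) (inv_into UNIV (F k) y)" if "k \<le> l" for k l y
    using inv_near[OF F[of l]] near[OF that] by blast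
  \<comment> \<open>Coordinate \<open>i\<close> is stable from stage \<open>Suc i\<close> on, since
    \<open>i < n (Suc i)\<close>.\<close>
  define h where "h x i = F (Suc i) x i" for x i
  define h' where "h' y i = inv_into UNIV (F (Suc i)) y i" for y i
  have h: "agree (n k) (h x) (F k x)" for k x
    unfolding agree_def
  proof (intro allI impI)
    fix i assume i: "i < n k"
    show "h x i = F k x i"
    proof (cases "Suc i \<le> k")
      case True
      moreover have "i < n (Suc i)"
        using n(1)[of "Suc i"] by simp
      ultimately show ?thesis
        using near[of "Suc i" k x] unfolding h_def agree_def by simp
    next
      case False
      then show ?thesis
        using near[of k "Suc i" x] i unfolding h_def agree_def by simp
    qed
  qed
  have h': "agree k (h' y) (inv_into UNIV (F k) y)" for k y
    unfolding agree_def
  proof (intro allI impI)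
    fix i assume "i < k"
    then show "h' y i = inv_into UNIV (F k) y i"
      using near'[of "Suc i" k y] unfolding h'_def agree_def by simp
  qed
  have cont_h: "continuous_on UNIV h"
    unfolding h_def by (intro continuous_cantorI loc_const_G[OF F loc_const_coord])
  have cont_h': "continuous_on UNIV h'"
    unfolding h'_def by (intro continuous_cantorI loc_const_G[OF inv_Homeo(2)[OF F] loc_const_coord])
  have "h (h' y) i = y i" for y i
  proof -
    obtain m where m: "\<And>x y. agree m x y \<Longrightarrow> agree (Suc i) (h x) (h y)"
      using continuous_modulus[OF cont_h] by blast
    \<comment> \<open>Stage \<open>l\<close> meets both the modulus \<open>m\<close> of the limit
      map and the depth needed to read coordinate \<open>i\<close>.\<close>
    define l where "l = max m (Suc i)"
    define z where "z = inv_into UNIV (F l) y"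
    have "agree (Suc i) (h (h' y)) (h z)"
      by (rule m, rule agree_mono[OF h'[of l y, folded z_def]]) (simp add: l_def)
    moreover have "agree (Suc i) (h z) (F l z)"
      by (rule agree_mono[OF h]) (use n(1)[of l] in \<open>simp add: l_def\<close>)
    moreover have "F l z = y"
      unfolding z_def using F by simp
    ultimately show ?thesis
      by (simp add: agree_def)
  qed
  moreover have "h' (h x) i = x i" for x i
  proof -
    obtain m where m: "\<And>x y. agree m x y \<Longrightarrow> agree (Suc i) (h' x) (h' y)"
      using continuous_modulus[OF cont_h'] by blast
    define l where "l = max m (Suc i)"
    have "agree (Suc i) (h' (h x)) (h' (F l x))"
      by (rule m, rule agree_mono[OF h]) (use n(1)[of l] in \<open>simp add: l_def\<close>)
    moreover have "agree (Suc i) (h' (F l x)) (inv_into UNIV (F l) (F l x))"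
      by (rule agree_mono[OF h']) (simp add: l_def)
    moreover have "inv_into UNIV (F l) (F l x) = x"
      using F by simp
    ultimately show ?thesis
      by (simp add: agree_def)
  qed
  ultimately have "h' \<circ> h = id" "h \<circ> h' = id"
    by (simp_all add: fun_eq_iff)
  then have "bij h"
    by (rule o_bij)
  moreover have "prob (h -` S) = prob S" if S: "clopen S" for S
  proof -
    obtain m where m: "\<forall>x y. agree m x y \<longrightarrow> (x \<in> S) = (y \<in> S)"
      using S unfolding clopen_iff_loc_const loc_const_def ..
    have "agree m (h x) (F m x)" for x
      by (rule agree_mono[OF h n(1)])
    then have "h -` S = F m -` S"
      using m by blast
    then show ?thesis
      using G_prob[OF F S] by simp
  qed
  ultimately have "h \<in> G"
    using cont_h by (simp add: G_iff)
  then show ?thesis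
    using h by (intro that) blast+
qed

definition approx_conjugate :: "nat \<Rightarrow> (cantor \<Rightarrow> cantor) \<Rightarrow> (cantor \<Rightarrow> cantor) \<Rightarrow> bool" where
  "approx_conjugate m g h \<longleftrightarrow> (\<exists>\<phi>\<in>G. \<forall>x. agree m (\<phi> (h (inv_into UNIV \<phi> x))) (g x))"

text \<open>Density and openness for the Baire argument. Approximate \<open>f\<close> and
  \<open>g\<close> by elements of the common period \<open>L1 * L2\<close>; these are conjugate, and
  continuity of the conjugator extends this approximately to all \<open>h\<close> near
  \<open>f'\<close>.\<close>

lemma approx_conjugate_step:
  assumes div: "\<forall>v\<in>clopen_values \<mu>. \<forall>K>0. v / real K \<in> clopen_values \<mu>"
    and f: "f \<in> G" and g: "g \<in> G"
  obtains f' n' where "f' \<in> G" "\<forall>x. agree n (f' x) (f x)"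
    "\<forall>h. (\<forall>x. agree n' (h x) (f' x)) \<longrightarrow> approx_conjugate m g h"
proof -
  obtain L1 where L1: "0 < L1"
    "\<forall>N>0. L1 dvd N \<longrightarrow> (\<exists>f'. periodic N f' \<and> (\<forall>x. agree n (f' x) (f x)))"
    using periodic_dense[OF div f] by blast
  obtain L2 where L2: "0 < L2"
    "\<forall>N>0. L2 dvd N \<longrightarrow> (\<exists>g'. periodic N g' \<and> (\<forall>x. agree m (g' x) (g x)))"
    using periodic_dense[OF div g] by blast
  obtain f' where f': "periodic (L1 * L2) f'" "\<forall>x. agree n (f' x) (f x)"
    using L1 L2(1) by (metis dvd_triv_left nat_0_less_mult_iff)
  obtain g' where g': "periodic (L1 * L2) g'" "\<forall>x. agree m (g' x) (g x)"
    using L2 L1(1) by (metis dvd_triv_right nat_0_less_mult_iff)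
  obtain \<phi> where \<phi>: "\<phi> \<in> G" "\<forall>x. \<phi> (f' x) = g' (\<phi> x)"
    using f'(1) g'(1) by (rule periodic_conjugate)
  obtain n' where n': "\<And>x y. agree n' x y \<Longrightarrow> agree m (\<phi> x) (\<phi> y)"
    using continuous_modulus[OF G_continuous[OF \<phi>(1)]] by blast
  have "approx_conjugate m g h" if h: "\<forall>x. agree n' (h x) (f' x)" for h
    unfolding approx_conjugate_def
  proof (intro bexI[OF _ \<phi>(1)] allI)
    fix x
    have "agree m (\<phi> (h (inv_into UNIV \<phi> x))) (\<phi> (f' (inv_into UNIV \<phi> x)))"
      using h by (intro n') blast
    also have "\<phi> (f' (inv_into UNIV \<phi> x)) = g' x"
      using \<phi> by simp
    finally show "agree m (\<phi> (h (inv_into UNIV \<phi> x))) (g x)"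
      using g'(2) agree_trans by blast
  qed
  moreover have "f' \<in> G"
    using f'(1) by (simp add: periodic_def)
  ultimately show ?thesis
    using f'(2) by (intro that) blast+
qed

text \<open>The Baire argument for countably many targets. A state is a group element with a depth,
  that is, a neighbourhood. Each next neighbourhood lies within the previous one and settles target
  \<open>k\<close>.\<close>

lemma generic_element:
  fixes g :: "nat \<Rightarrow> cantor \<Rightarrow> cantor" and m :: "nat \<Rightarrow> nat"
  assumes div: "\<forall>v\<in>clopen_values \<mu>. \<forall>K>0. v / real K \<in> clopen_values \<mu>"
    and g: "\<And>k. g k \<in> G"
  obtains h where "h \<in> G" "\<forall>k. approx_conjugate (m k) (g k) h"
proof -
  define P :: "nat \<Rightarrow> (cantor \<Rightarrow> cantor) \<times> nat \<Rightarrow> bool" where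
    "P k p \<longleftrightarrow> fst p \<in> G \<and> k \<le> snd p \<and> (\<forall>h\<in>G. (\<forall>x. agree (snd p) (h x) (fst p x)) \<longrightarrow>
      (\<forall>y. agree k (inv_into UNIV h y) (inv_into UNIV (fst p) y)))" for k p
  define Q :: "nat \<Rightarrow> (cantor \<Rightarrow> cantor) \<times> nat \<Rightarrow> (cantor \<Rightarrow> cantor) \<times> nat \<Rightarrow> bool" where
    "Q k p q \<longleftrightarrow> snd p \<le> snd q \<and> (\<forall>x. agree (snd p) (fst q x) (fst p x)) \<and>
      (\<forall>h. (\<forall>x. agree (snd q) (h x) (fst q x)) \<longrightarrow> approx_conjugate (m k) (g k) h)" for k p q
  have "\<exists>s. \<forall>k. P k (s k) \<and> Q k (s k) (s (Suc k))"
  proof (rule dependent_nat_choice)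
    have "P 0 (id, 0)"
      unfolding P_def using G_id by (simp add: agree_def)
    then show "\<exists>p. P 0 p" ..
  next
    fix p k assume "P k p"
    then have "fst p \<in> G"
      by (simp add: P_def)
    from this g[of k] obtain f' n' where f': "f' \<in> G" "\<forall>x. agree (snd p) (f' x) (fst p x)"
      and n': "\<forall>h. (\<forall>x. agree n' (h x) (f' x)) \<longrightarrow> approx_conjugate (m k) (g k) h"
      by (rule approx_conjugate_step[OF div])
    obtain n'' where n'': "\<forall>h\<in>G. (\<forall>x. agree n'' (h x) (f' x)) \<longrightarrow>
        (\<forall>y. agree (Suc k) (inv_into UNIV h y) (inv_into UNIV f' y))"
      using f'(1) by (rule inv_agree)
    \<comment> \<open>The new depth keeps the depths increasing and at least \<open>Suc k\<close>,
      secures conjugacy (\<open>n'\<close>) and controls inverses for the limit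
      (\<open>n''\<close>).\<close>
    define l where "l = Max {snd p, Suc k, n', n''}"
    have l: "snd p \<le> l" "Suc k \<le> l" "n' \<le> l" "n'' \<le> l"
      unfolding l_def by (rule Max_ge; simp)+
    have "P (Suc k) (f', l)"
      unfolding P_def using f'(1) l(2) n'' agree_mono[OF _ l(4)] by simp
    moreover have "Q k p (f', l)"
      unfolding Q_def using f'(2) l(1) n' agree_mono[OF _ l(3)] by simp
    ultimately show "\<exists>q. P (Suc k) q \<and> Q k p q"
      by blast
  qed
  then obtain s where s: "\<forall>k. P k (s k) \<and> Q k (s k) (s (Suc k))" ..
  then have P: "P k (s k)" and Q: "Q k (s k) (s (Suc k))" for k
    by blast+
  obtain h where h: "h \<in> G" "\<forall>k x. agree (snd (s k)) (h x) (fst (s k) x)"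
  proof (rule limit_in_G[of "\<lambda>k. fst (s k)" "\<lambda>k. snd (s k)"])
    show "fst (s k) \<in> G" "k \<le> snd (s k)" for k
      using P[of k] by (simp_all add: P_def)
    show "snd (s k) \<le> snd (s (Suc k))" "agree (snd (s k)) (fst (s (Suc k)) x) (fst (s k) x)" for k x
      using Q[of k] unfolding Q_def by blast+
    show "\<forall>y. agree k (inv_into UNIV h y) (inv_into UNIV (fst (s k)) y)"
      if "h \<in> G" "\<forall>x. agree (snd (s k)) (h x) (fst (s k) x)" for k h
      using P[of k] that unfolding P_def by blast
  qed
  have "approx_conjugate (m k) (g k) h" for k
    using Q[of k] h(2)[rule_format, of "Suc k"] unfolding Q_def by blast
  then show ?thesis
    using h(1) by (intro that) blast+
qed

text \<open>Countably many targets suffice: one representative of each period, at each depth. Any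
  \<open>f\<close> is close to some periodic \<open>f'\<close>, and \<open>f'\<close> is conjugate
  to the representative of its period.\<close>

lemma divisible_imp_Rokhlin:
  assumes div: "\<forall>v\<in>clopen_values \<mu>. \<forall>K>0. v / real K \<in> clopen_values \<mu>"
  shows "Rokhlin_property (Homeo \<mu>) (Homeo_topology \<mu>)"
proof -
  \<comment> \<open>Where no element has period \<open>N\<close>, the default \<open>id\<close>
    keeps the sequence in \<open>G\<close>.\<close>
  define rep where "rep N = (if \<exists>g. periodic N g then SOME g. periodic N g else id)" for N
  have rep: "periodic N (rep N)" if "periodic N g" for N g
    using someI[of "periodic N", OF that] that unfolding rep_def by auto
  have rep_G: "rep N \<in> G" for N
  proof (cases "\<exists>g. periodic N g")
    case True
    then show ?thesis using rep unfolding periodic_def by blast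
  next
    case False
    then show ?thesis unfolding rep_def by (simp only: if_False G_id)
  qed
  obtain h where h: "h \<in> G"
    and app: "\<forall>k. approx_conjugate (snd (prod_decode k)) (rep (fst (prod_decode k))) h"
    by (rule generic_element[where g = "\<lambda>k. rep (fst (prod_decode k))"
          and m = "\<lambda>k. snd (prod_decode k)", OF div rep_G])
  have "\<exists>\<phi>\<in>G. \<forall>x. agree n (\<phi> (h (inv_into UNIV \<phi> x))) (f x)" if f: "f \<in> G" for f n
  proof -
    obtain L where "0 < L"
      "\<forall>N>0. L dvd N \<longrightarrow> (\<exists>f'. periodic N f' \<and> (\<forall>x. agree n (f' x) (f x)))"
      using periodic_dense[OF div f] by blast
    then obtain f' where f': "periodic L f'" "\<forall>x. agree n (f' x) (f x)"
      by (metis dvd_refl)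
    obtain \<psi> where \<psi>: "\<psi> \<in> G" "\<forall>x. \<psi> (rep L x) = f' (\<psi> x)"
      using rep[OF f'(1)] f'(1) by (rule periodic_conjugate)
    obtain m where m: "\<And>x y. agree m x y \<Longrightarrow> agree n (\<psi> x) (\<psi> y)"
      using continuous_modulus[OF G_continuous[OF \<psi>(1)]] by blast
    have "approx_conjugate m (rep L) h"
      using app[rule_format, of "prod_encode (L, m)"] by simp
    then obtain \<phi> where \<phi>: "\<phi> \<in> G" "\<forall>x. agree m (\<phi> (h (inv_into UNIV \<phi> x))) (rep L x)"
      unfolding approx_conjugate_def by blast
    have inv: "inv_into UNIV (\<psi> \<circ> \<phi>) x = inv_into UNIV \<phi> (inv_into UNIV \<psi> x)" for x
      using o_inv_distrib[OF G_bij[OF \<psi>(1)] G_bij[OF \<phi>(1)]] by simp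
    show ?thesis
    proof (intro bexI[of _ "\<psi> \<circ> \<phi>"] allI)
      fix x
      define z where "z = inv_into UNIV \<psi> x"
      have "agree n (\<psi> (\<phi> (h (inv_into UNIV \<phi> z)))) (\<psi> (rep L z))"
        using \<phi>(2) by (intro m) blast
      also have "\<psi> (rep L z) = f' x"
        using \<psi> by (simp add: z_def)
      finally show "agree n ((\<psi> \<circ> \<phi>) (h (inv_into UNIV (\<psi> \<circ> \<phi>) x))) (f x)"
        unfolding inv z_def[symmetric] comp_apply using f'(2) agree_trans by blast
    qed (rule G_comp[OF \<psi>(1) \<phi>(1)])
  qed
  then show ?thesis
    unfolding Rokhlin_Homeo_iff using h by blast
qed

text \<open>One conjugator pulls the levels of an element of period \<open>N\<close> back to levels
  that \<open>h\<close> permutes cyclically; another, with target \<open>id\<close>, pulls a clopen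
  set of measure \<open>v\<close> back to an \<open>h\<close>-invariant set. That set meets level
  \<open>0\<close> in measure \<open>v / N\<close>.\<close>

lemma Rokhlin_imp_divisible:
  assumes R: "Rokhlin_property (Homeo \<mu>) (Homeo_topology \<mu>)"
    and N: "0 < N" "1 / real N \<in> clopen_values \<mu>" and v: "v \<in> clopen_values \<mu>"
  shows "v / real N \<in> clopen_values \<mu>"
proof -
  obtain h where h: "h \<in> G"
    and dense: "\<And>f n. f \<in> G \<Longrightarrow> \<exists>\<phi>\<in>G. \<forall>x. agree n (\<phi> (h (inv_into UNIV \<phi> x))) (f x)"
    using R unfolding Rokhlin_Homeo_iff by blast
  \<comment> \<open>Density read through a finite labelling: approximation to the depth of
    \<open>p\<close> makes the labels coincide exactly.\<close>
  have pull: "\<exists>\<phi>\<in>G. \<forall>y. p (\<phi> (h y)) = p (f (\<phi> y))" if f: "f \<in> G" and p: "loc_const p"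
    for f and p :: "cantor \<Rightarrow> nat"
  proof -
    obtain n where n: "\<forall>x y. agree n x y \<longrightarrow> p x = p y"
      using p unfolding loc_const_def ..
    obtain \<phi> where \<phi>: "\<phi> \<in> G" "\<forall>x. agree n (\<phi> (h (inv_into UNIV \<phi> x))) (f x)"
      using dense[OF f] by blast
    have "p (\<phi> (h y)) = p (f (\<phi> y))" for y
      using n \<phi>(2)[rule_format, of "\<phi> y"] \<phi>(1) by simp
    then show ?thesis
      using \<phi>(1) by blast
  qed
  have "(\<Sum>i\<in>{..<N}. 1 / real N) \<le> prob UNIV"
    using N(1) prob_space by simp
  then obtain A where A: "\<forall>i\<in>{..<N}. clopen (A i) \<and> A i \<subseteq> UNIV \<and> prob (A i) = 1 / real N"
    and disj: "disjoint_family_on A {..<N}"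
    using disjoint_clopens[OF clopen_UNIV, of "{..<N}" "\<lambda>_. 1 / real N"] N(2) by auto
  obtain t where t: "loc_const t" and tA: "\<forall>i\<in>{..<N}. \<forall>x\<in>A i. t x = i"
    using loc_const_label[of "{..<N}" A] A disj by auto
  have clU: "clopen (\<Union>i\<in>{..<N}. A i)"
    using A by (intro clopen_UN) auto
  have "prob (\<Union>i\<in>{..<N}. A i) = 1"
    using A disj N(1) by (subst prob_UN_clopen) auto
  then have "prob (UNIV - (\<Union>i\<in>{..<N}. A i)) = 0"
    using prob_space by (subst prob_Diff_clopen) (auto intro: clU)
  then have "UNIV - (\<Union>i\<in>{..<N}. A i) = {}"
    by (intro clopen_null clopen_Diff clU) auto
  then have cover: "\<exists>i<N. x \<in> A i" for x
    by auto
  have tN: "t x < N" for x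
    using cover[of x] tA by auto
  have tA': "{x. t x = a} = A a" if "a < N" for a
  proof (intro antisym subsetI)
    fix x assume "x \<in> {x. t x = a}"
    moreover obtain i where "i < N" "x \<in> A i"
      using cover by blast
    ultimately show "x \<in> A a"
      using tA by auto
  qed (use tA that in auto)
  \<comment> \<open>A single tower over the whole space, hence the constant tower number
    \<open>0\<close>.\<close>
  have "\<exists>f. periodic N f \<and> (\<forall>x. t (f x) = Suc (t x) mod N \<and> (0::nat) = 0)"
  proof (rule periodic_exists[OF t tN loc_const_const])
    show "prob {x. t x = a \<and> 0 = k} = prob {x. t x = 0 \<and> 0 = k}" if "a < N" for a k :: nat
      using that A N(1) by (cases k) (simp_all add: tA')
  qed
  then obtain f where f: "f \<in> G" "\<And>x. t (f x) = Suc (t x) mod N"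
    unfolding periodic_def by blast
  obtain C where C: "clopen C" "prob C = v"
    using v by (auto simp: clopen_values_def)
  obtain \<phi> where \<phi>: "\<phi> \<in> G" "\<forall>y. t (\<phi> (h y)) = t (f (\<phi> y))"
    using pull[OF f(1) t] by blast
  have "loc_const (\<lambda>x. if x \<in> C then 1 else 0 :: nat)"
    using C(1) unfolding clopen_iff_loc_const by (rule loc_const_comp)
  then obtain \<psi> where \<psi>: "\<psi> \<in> G" "\<forall>y. (if \<psi> (h y) \<in> C then 1 else 0 :: nat) = (if id (\<psi> y) \<in> C then 1 else 0)"
    using pull[OF G_id] by blast
  have "prob (\<psi> -` C \<inter> (\<lambda>x. t (\<phi> x)) -` {0}) = prob (\<psi> -` C) / N"
  proof (rule periodic_level_prob[OF h _ _ _ _ _ N(1)])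
    show "loc_const (\<lambda>x. t (\<phi> x))"
      by (rule loc_const_G[OF \<phi>(1) t])
    show "clopen (\<psi> -` C)"
      by (rule clopen_continuous_vimage[OF G_continuous[OF \<psi>(1)] C(1)])
    show "h x \<in> \<psi> -` C \<longleftrightarrow> x \<in> \<psi> -` C" for x
      using \<psi>(2)[rule_format, of x] by (auto split: if_splits)
  qed (use \<phi>(2) f(2) tN in auto)
  moreover have "prob (\<psi> -` C) = v"
    using G_prob[OF \<psi>(1) C(1)] C(2) by simp
  moreover have "clopen (\<psi> -` C \<inter> (\<lambda>x. t (\<phi> x)) -` {0})"
    by (intro clopen_Int clopen_continuous_vimage[OF G_continuous[OF \<psi>(1)] C(1)]
        clopen_vimage_loc_const loc_const_G[OF \<phi>(1) t])
  ultimately show ?thesis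
    using prob_in_values by force
qed

end

subsection \<open>Group-like sets\<close>

lemma group_like_closed:
  assumes "group_like V"
  shows "0 \<in> V + \<int>" "x \<in> V + \<int> \<Longrightarrow> y \<in> V + \<int> \<Longrightarrow> x + y \<in> V + \<int>" "x \<in> V + \<int> \<Longrightarrow> - x \<in> V + \<int>"
proof -
  have sub: "subgroup (V + \<int>) real_add_group"
    using assms by (simp add: group_like_def)
  have grp: "group real_add_group"
  proof (rule groupI)
    show "\<exists>y\<in>carrier real_add_group. y \<otimes>\<^bsub>real_add_group\<^esub> x = \<one>\<^bsub>real_add_group\<^esub>" for x
      by (rule bexI[of _ "- x"]) (simp_all add: real_add_group_def)
  qed (simp_all add: real_add_group_def)
  have inv: "inv\<^bsub>real_add_group\<^esub> x = - x" for x
    by (rule group.inv_equality[OF grp]) (simp_all add: real_add_group_def)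
  show "0 \<in> V + \<int>"
    using subgroup.one_closed[OF sub] by (simp add: real_add_group_def)
  show "x + y \<in> V + \<int>" if "x \<in> V + \<int>" "y \<in> V + \<int>"
    using subgroup.m_closed[OF sub that] by (simp add: real_add_group_def)
  show "- x \<in> V + \<int>" if "x \<in> V + \<int>"
    using subgroup.m_inv_closed[OF sub that] by (simp add: inv)
qed

text \<open>Write \<open>x\<close> as \<open>v + k\<close>. As both \<open>x\<close> and
  \<open>v\<close> lie in the unit interval, \<open>k\<close> is \<open>-1\<close>, \<open>0\<close>
  or \<open>1\<close>, and a nonzero \<open>k\<close> leaves only the endpoints, which belong to
  \<open>V\<close>.\<close>

lemma group_like_unit_interval:
  assumes "group_like V" "x \<in> V + \<int>" "0 \<le> x" "x \<le> 1"
  shows "x \<in> V"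
proof -
  have V: "0 \<in> V" "1 \<in> V" "V \<subseteq> {0..1}"
    using assms(1) by (auto simp: group_like_def)
  obtain v k where vk: "v \<in> V" "x = v + of_int k"
    using assms(2) by (auto elim!: set_plus_elim Ints_cases)
  have v: "0 \<le> v" "v \<le> 1"
    using vk(1) V(3) by auto
  then have "of_int k \<le> (1::real)" "(-1::real) \<le> of_int k"
    using assms(3,4) vk(2) by linarith+
  then have "k = -1 \<or> k = 0 \<or> k = 1"
    by linarith
  then have "x = 0 \<or> x = v \<or> x = 1"
    using v assms(3,4) vk(2) by auto
  then show ?thesis
    using V vk(1) by auto
qed

lemma subset_plus_Ints: "v \<in> V \<Longrightarrow> v \<in> V + (\<int> :: real set)"
  using set_plus_intro[of v V 0 \<int>] by simp

lemma Q_like_iff: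
  assumes "group_like V"
  shows "Q_like V \<longleftrightarrow> (\<forall>q x. x \<in> V + \<int> \<longrightarrow> of_rat q * x \<in> V + \<int>)"
proof -
  have "module (\<lambda>(q::rat) (x::real). of_rat q * x)"
    by unfold_locales (simp_all add: algebra_simps of_rat_add of_rat_mult)
  then show ?thesis
    using assms group_like_closed[OF assms] by (auto simp: Q_like_def module.subspace_def)
qed

text \<open>Forward, scale \<open>1\<close> by \<open>q\<close> and \<open>v\<close> by
  \<open>1 / K\<close> and return to the unit interval. Conversely, for \<open>x = v + z\<close> and
  \<open>q = a / b\<close>, the quotient \<open>x / b\<close> splits into \<open>v / b\<close>,
  covered by divisibility, and the rational \<open>z / b\<close>, covered through its fractional
  part; then take the multiple by \<open>a\<close>.\<close>

lemma Q_like_divisible: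
  assumes V: "group_like V"
  shows "Q_like V \<longleftrightarrow> \<rat> \<inter> {0..1} \<subseteq> V \<and> (\<forall>v\<in>V. \<forall>K>0. v / real K \<in> V)"
proof (intro iffI conjI subsetI ballI allI impI)
  assume "Q_like V"
  then have scale: "of_rat q * x \<in> V + \<int>" if "x \<in> V + \<int>" for q x
    using that by (simp add: Q_like_iff[OF V])
  have V01: "1 \<in> V" "V \<subseteq> {0..1}"
    using V by (auto simp: group_like_def)
  show "x \<in> V" if "x \<in> \<rat> \<inter> {0..1}" for x
  proof -
    have "x \<in> \<rat>"
      using that by simp
    then obtain q where "x = of_rat q"
      by (rule Rats_cases)
    then show ?thesis
      using that scale[OF subset_plus_Ints[OF V01(1)], of q] by (intro group_like_unit_interval[OF V]) auto
  qed
  show "v / real K \<in> V" if "v \<in> V" "0 < K" for v K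
  proof (rule group_like_unit_interval[OF V])
    show "v / real K \<in> V + \<int>"
      using scale[OF subset_plus_Ints[OF that(1)], of "1 / of_nat K"] by (simp add: of_rat_divide)
    have "0 \<le> v" "v \<le> 1"
      using that V01(2) by auto
    then show "0 \<le> v / real K" "v / real K \<le> 1"
      using that(2) by (simp_all add: divide_le_eq)
  qed
next
  assume *: "\<rat> \<inter> {0..1} \<subseteq> V \<and> (\<forall>v\<in>V. \<forall>K>0. v / real K \<in> V)"
  have Rats: "q \<in> V + \<int>" if "q \<in> \<rat>" for q :: real
  proof -
    have "frac q \<in> \<rat> \<inter> {0..1}"
      using that frac_lt_1[of q] by (auto simp: frac_def frac_ge_0 intro!: Rats_diff Rats_of_int less_imp_le)
    then have "frac q + of_int \<lfloor>q\<rfloor> \<in> V + \<int>"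
      using * by (intro set_plus_intro) auto
    then show ?thesis
      by (simp add: frac_def)
  qed
  have multiple: "of_int a * x \<in> V + \<int>" if x: "x \<in> V + \<int>" for a x
  proof -
    have nat: "of_nat k * x \<in> V + \<int>" for k
      using x by (induction k) (simp_all add: group_like_closed[OF V] distrib_right)
    show ?thesis
      using nat[of "nat a"] group_like_closed(3)[OF V nat[of "nat (- a)"]]
      by (cases "0 \<le> a") simp_all
  qed
  have "of_rat q * x \<in> V + \<int>" if "x \<in> V + \<int>" for q x
  proof -
    obtain v z where x: "v \<in> V" "z \<in> \<int>" "x = v + z"
      using \<open>x \<in> V + \<int>\<close> by (auto elim!: set_plus_elim)
    obtain a b where q: "q = Fract a b" "0 < b"
      by (cases q) auto
    have "v / of_int b \<in> V"
      using *[THEN conjunct2, rule_format, OF x(1), of "nat b"] q(2) by simp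
    then have "v / of_int b \<in> V + \<int>"
      by (rule subset_plus_Ints)
    moreover have "z / of_int b \<in> V + \<int>"
      using x(2) by (intro Rats) (auto elim!: Ints_cases)
    ultimately have "v / of_int b + z / of_int b \<in> V + \<int>"
      by (rule group_like_closed(2)[OF V])
    from multiple[OF this, of a] show ?thesis
      using q(2) by (simp add: q(1) of_rat_rat x(3) add_divide_distrib[symmetric])
  qed
  then show "Q_like V"
    by (simp add: Q_like_iff[OF V])
qed

theorem lemma5p9:
  fixes V :: "real set" and \<mu> :: "cantor measure"
  assumes "group_like V"
    and "is_mu V \<mu>"
  shows "Q_like V \<longleftrightarrow>
    \<rat> \<inter> {0..1} \<subseteq> V \<and> Rokhlin_property (Homeo \<mu>) (Homeo_topology \<mu>)"
proof -
  interpret good_cantor \<mu>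
    using assms(2) by unfold_locales (simp add: is_mu_def)
  have V: "clopen_values \<mu> = V"
    using assms(2) by (simp add: is_mu_def)
  show ?thesis
    unfolding Q_like_divisible[OF assms(1)]
  \<comment> \<open>The inclusion of the rationals is common to both sides, and
    \<open>conj_cong\<close> makes it available in comparing the rest: it supplies the value
    \<open>1 / K\<close> from which the Rokhlin property yields divisibility by
    \<open>K\<close>.\<close>
  proof (intro conj_cong refl iffI ballI allI impI)
    assume "\<forall>v\<in>V. \<forall>K>0. v / real K \<in> V"
    then show "Rokhlin_property (Homeo \<mu>) (Homeo_topology \<mu>)"
      by (intro divisible_imp_Rokhlin) (simp add: V)
  next
    fix v K assume Q: "\<rat> \<inter> {0..1} \<subseteq> V" and R: "Rokhlin_property (Homeo \<mu>) (Homeo_topology \<mu>)"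
      and v: "v \<in> V" and K: "0 < (K::nat)"
    have "1 / real K \<in> \<rat> \<inter> {0..1}"
      using K by simp
    then have "1 / real K \<in> V"
      using Q by blast
    then show "v / real K \<in> V"
      using Rokhlin_imp_divisible[OF R K] v by (simp add: V)
  qed
qed

end
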